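(* There exist universal constants $c,c'>0$ and $d_0\in\mathbb N$ such that the following holds. Let $d\ge d_0$, $n\in\mathbb N$, $\xi\in(0,1/e)$ and $\alpha>0$ satisfy $$c\sqrt{\frac{\log d}{n}}\le\alpha\le\min\left\{c\cdot\frac{d^{0.49}}{n\sqrt{\log(1/\xi)}},\ \frac18\right\}.$$ Let $\mathcal Z=\{\pm1\}^d$ and suppose a (possibly randomized) estimator is given which, from i.i.d. samples $Z_1,\dots,Z_n\in\mathcal Z$, outputs $\hat\mu\in\mathbb R^d$ with $$\mathbb E\|\hat\mu-\mathbb E[Z_1]\|_\infty\le\alpha/2$$ for every distribution of $Z_1$ on $\mathcal Z$. Then the estimator $\hat\mu$ is $(\xi,m)$-traceable for some $m\ge c'\log(d)/\alpha^2$ (i.e. $m\in\Omega(\log(d)/\alpha^2)$).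
   Context: Tracing: an estimator is a map $\mathcal A_n$ from $\mathcal Z^n$ to probability measures on $\mathbb R^d$, with $\hat\mu\sim\mathcal A_n(Z_1,\dots,Z_n)$. It is $(\xi,m)$-traceable ($\xi\in(0,1)$, $m$ a real number) if there exist a measurable function $\phi:\mathbb R^d\times\mathcal Z\to\mathbb R$, a probability measure $\mathcal D$ on $\mathcal Z$ and $\lambda\in\mathbb R$ such that, if $(Z_0,Z_1,\dots,Z_n)\sim\mathcal D^{\otimes(n+1)}$ and $\hat\mu\sim\mathcal A_n(Z_1,\dots,Z_n)$ (independently of $Z_0$ given the sample), then (i) $\Pr(\phi(\hat\mu,Z_0)\ge\lambda)\le\xi$, and (ii) $\mathbb E\big[|\{i\in[n]:\phi(\hat\mu,Z_i)\ge\lambda\}|\big]\ge m$. *)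

theory Defs
  imports "HOL-Probability.Probability"
begin

text \<open>The dimension is quantified inside the statement, so \<open>\<real>\<^sup>d\<close> consists of the functions
  \<open>nat \<Rightarrow> real\<close> that are extensional on \<open>{..<d}\<close>, with the product Borel \<open>\<sigma>\<close>-algebra.\<close>

definition Rd :: "nat \<Rightarrow> (nat \<Rightarrow> real) measure" where
  "Rd d = PiM {..<d} (\<lambda>_. borel)"

text \<open>The \<open>0\<close> only matters for \<open>d = 0\<close>, where the maximum would be over the empty set.\<close>

definition linf_norm :: "nat \<Rightarrow> (nat \<Rightarrow> real) \<Rightarrow> real" where
  "linf_norm d x = Max (insert 0 ((\<lambda>j. \<bar>x j\<bar>) ` {..<d}))"

definition sign_cube :: "nat \<Rightarrow> (nat \<Rightarrow> real) measure" where
  "sign_cube d = count_space ({..<d} \<rightarrow>\<^sub>E {-1, 1})"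

text \<open>A randomized estimator with data domain \<open>Z\<close> is a Markov kernel from samples, indexed by
  \<open>{1..n}\<close>, to \<open>\<real>\<^sup>d\<close>. For the discrete domain \<open>sign_cube\<close> the measurability requirement is
  vacuous, see \<open>estimator_sign_cube_iff\<close> below.\<close>

definition estimator ::
    "'z measure \<Rightarrow> nat \<Rightarrow> nat \<Rightarrow> ((nat \<Rightarrow> 'z) \<Rightarrow> (nat \<Rightarrow> real) measure) \<Rightarrow> bool" where
  "estimator Z d n A \<longleftrightarrow> A \<in> PiM {1..n} (\<lambda>_. Z) \<rightarrow>\<^sub>M prob_algebra (Rd d)"

text \<open>The law of the estimate on \<open>n\<close> i.i.d. samples from \<open>D\<close>.\<close>

definition estimate_law ::
    "nat \<Rightarrow> ((nat \<Rightarrow> 'z) \<Rightarrow> (nat \<Rightarrow> real) measure) \<Rightarrow> 'z measure \<Rightarrow> (nat \<Rightarrow> real) measure" where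
  "estimate_law n A D = PiM {1..n} (\<lambda>_. D) \<bind> A"

text \<open>The joint law of \<open>((Z\<^sub>0, \<dots>, Z\<^sub>n), \<mu>)\<close>: the estimate only sees \<open>Z\<^sub>1, \<dots>, Z\<^sub>n\<close>, so that
  \<open>Z\<^sub>0\<close> is a fresh point, independent of \<open>\<mu>\<close> given the sample.\<close>

definition tracing_law ::
    "nat \<Rightarrow> nat \<Rightarrow> ((nat \<Rightarrow> 'z) \<Rightarrow> (nat \<Rightarrow> real) measure) \<Rightarrow> 'z measure
      \<Rightarrow> ((nat \<Rightarrow> 'z) \<times> (nat \<Rightarrow> real)) measure" where
  "tracing_law d n A D =
     PiM {0..n} (\<lambda>_. D) \<bind> (\<lambda>S. A (restrict S {1..n}) \<bind>
       (\<lambda>\<mu>. return (PiM {0..n} (\<lambda>_. D) \<Otimes>\<^sub>M Rd d) (S, \<mu>)))"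

definition traceable ::
    "'z measure \<Rightarrow> nat \<Rightarrow> nat \<Rightarrow> ((nat \<Rightarrow> 'z) \<Rightarrow> (nat \<Rightarrow> real) measure) \<Rightarrow> real \<Rightarrow> real \<Rightarrow> bool" where
  "traceable Z d n A \<xi> m \<longleftrightarrow> 0 < \<xi> \<and> \<xi> < 1 \<and>
     (\<exists>\<phi> \<in> borel_measurable (Rd d \<Otimes>\<^sub>M Z). \<exists>D \<in> space (prob_algebra Z). \<exists>l::real.
        measure (tracing_law d n A D)
          {(S, \<mu>) \<in> space (tracing_law d n A D). \<phi> (\<mu>, S 0) \<ge> l} \<le> \<xi> \<and>
        (\<integral>(S, \<mu>). real (card {i \<in> {1..n}. \<phi> (\<mu>, S i) \<ge> l}) \<partial>tracing_law d n A D) \<ge> m)"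

lemma estimator_sign_cube_iff:
  "estimator (sign_cube d) d' n A \<longleftrightarrow>
     (\<forall>S \<in> {1..n} \<rightarrow>\<^sub>E ({..<d} \<rightarrow>\<^sub>E {-1, 1}). A S \<in> space (prob_algebra (Rd d')))"
proof -
  have "countable ({..<d} \<rightarrow>\<^sub>E {-1, 1::real})"
    by (intro countable_finite finite_PiE) auto
  then have "PiM {1..n} (\<lambda>_. sign_cube d) = count_space ({1..n} \<rightarrow>\<^sub>E ({..<d} \<rightarrow>\<^sub>E {-1, 1}))"
    unfolding sign_cube_def by (intro count_space_PiM_finite) auto
  then show ?thesis
    by (auto simp: estimator_def)
qed

text \<open>The iterated \<open>\<bind>\<close> in \<open>tracing_law\<close> is along measurable kernels, so it is not a junk value.\<close>

lemma tracing_law_in_prob_algebra: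
  assumes A: "estimator Z d n A" and D: "D \<in> space (prob_algebra Z)"
  shows "tracing_law d n A D \<in> space (prob_algebra (PiM {0..n} (\<lambda>_. D) \<Otimes>\<^sub>M Rd d))"
proof -
  have sD: "sets D = sets Z" and pD: "prob_space D"
    using D by (auto simp: space_prob_algebra)
  have sP: "sets (PiM {1..n} (\<lambda>_. D)) = sets (PiM {1..n} (\<lambda>_. Z))"
    by (intro sets_PiM_cong) (auto simp: sD)
  have [measurable]: "A \<in> PiM {1..n} (\<lambda>_. D) \<rightarrow>\<^sub>M prob_algebra (Rd d)"
    using A unfolding estimator_def measurable_cong_sets[OF sP refl] .
  have [measurable]: "(\<lambda>S. restrict S {1..n}) \<in> PiM {0..n} (\<lambda>_. D) \<rightarrow>\<^sub>M PiM {1..n} (\<lambda>_. D)"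
    by (intro measurable_restrict_subset) auto
  define P where "P = PiM {0..n} (\<lambda>_. D)"
  define K where "K = (\<lambda>S. A (restrict S {1..n}) \<bind> (\<lambda>\<mu>. return (P \<Otimes>\<^sub>M Rd d) (S, \<mu>)))"
  have K: "K \<in> P \<rightarrow>\<^sub>M prob_algebra (P \<Otimes>\<^sub>M Rd d)"
    unfolding K_def P_def by (rule measurable_bind_prob_space2[where N = "Rd d"]) measurable
  have "P \<in> space (prob_algebra P)"
    unfolding P_def by (auto simp: space_prob_algebra intro!: prob_space_PiM pD)
  then have "(\<lambda>_. P \<bind> K) \<in> count_space (UNIV :: unit set) \<rightarrow>\<^sub>M prob_algebra (P \<Otimes>\<^sub>M Rd d)"
    by (intro measurable_bind_prob_space[OF _ K]) auto
  then have "P \<bind> K \<in> space (prob_algebra (P \<Otimes>\<^sub>M Rd d))"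
    by (auto dest: measurable_space)
  then show ?thesis
    by (simp add: tracing_law_def K_def P_def)
qed

end

(* Partition the coordinates into s blocks of size about d^0.01 and let J be the set of the s
   coordinates where the estimate is maximal in its block. The score of a data point z against the
   estimate is the sum of z_j - p_j over J. On a fresh point it is a sum of s bounded centred
   variables, hence at most sqrt (2 s ln (1/xi)) except with probability xi.
   For the means p draw the coordinates independently with density proportional to (1 - x^2)^k on
   [-1, 1]. By conjugacy the expected total score of the sample is 2 (k+1) times the expectation of
   the sum of p_j over J. With k of order ln d / alpha^2 a block has a mean above 3 alpha with
   probability close to 1, and an accurate estimate selects means that are almost maximal, so some
   p gives a total score of order s ln d / alpha.
   A union bound over the possible J shows that points with score above the threshold contribute
   on average O(alpha s) each, up to a small error, and the other points contribute at most n times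
   the threshold, which is negligible because alpha <= d^0.49 / (n sqrt (ln (1/xi))). Hence the
   expected number of traced points is at least of order ln d / alpha^2. *)

theory Submission
  imports Defs "HOL-Real_Asymp.Real_Asymp"
begin

section \<open>Scores under product distributions on the cube\<close>

text \<open>Accuracy \<alpha>/2 says nothing about a typical mean: under the prior these have size
  about 1/sqrt k, which is below \<alpha>. Only extreme means are visible to the estimate, hence the
  maximisation over blocks. The maximum of d^0.01 such means has order sqrt (ln d / k), and this has
  to reach 3 \<alpha>; that fixes the order of k. Many blocks are needed because the false positive
  bound forces a threshold growing like sqrt s, while the total score grows like s: n thresholds
  cost about sqrt s * d^0.49 / \<alpha>, and sqrt s is about d^0.495. The obstacle is that J depends
  on the sample, so that the score of a sample point is not a sum of centred variables. The union
  bound over J costs s ln b + n in the exponent, where n \<le> s because the two bounds on \<alpha>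
  together give n ln d \<le> d^0.98. Divided by \<eta> of order \<alpha>, this cost has the same
  order s ln d / \<alpha> as the total score, so here only the constants decide. The number of
  traced points is the remaining score k \<alpha> s over the cap \<eta> s / 2, hence of order
  k.\<close>

definition cube :: "nat \<Rightarrow> (nat \<Rightarrow> real) set" where
  "cube d = {..<d} \<rightarrow>\<^sub>E {-1, 1}"

text \<open>Likelihood of \<open>z\<close> under independent signs with means \<open>p j\<close>: as
  \<open>z j\<close> is 1 or -1, each factor is the probability of that sign. Expectations over the
  cube are written as finite sums against this weight.\<close>

definition cube_weight :: "nat \<Rightarrow> (nat \<Rightarrow> real) \<Rightarrow> (nat \<Rightarrow> real) \<Rightarrow> real" where
  "cube_weight d p z = (\<Prod>j<d. (1 + p j * z j) / 2)"

definition sample_weight ::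
    "nat \<Rightarrow> (nat \<Rightarrow> real) \<Rightarrow> nat set \<Rightarrow> (nat \<Rightarrow> nat \<Rightarrow> real) \<Rightarrow> real" where
  "sample_weight d p I S = (\<Prod>i\<in>I. cube_weight d p (S i))"

definition score :: "nat set \<Rightarrow> (nat \<Rightarrow> real) \<Rightarrow> (nat \<Rightarrow> real) \<Rightarrow> real" where
  "score J p z = (\<Sum>j\<in>J. z j - p j)"

lemma finite_cube [simp]: "finite (cube d)"
  by (simp add: cube_def finite_PiE)

lemma finite_samples [simp]: "finite I \<Longrightarrow> finite (I \<rightarrow>\<^sub>E cube d)"
  by (simp add: finite_PiE)

lemma cube_weight_nonneg:
  assumes "\<forall>j<d. \<bar>p j\<bar> \<le> 1" "z \<in> cube d"
  shows "cube_weight d p z \<ge> 0"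
  unfolding cube_weight_def
proof (rule prod_nonneg)
  fix j assume "j \<in> {..<d}"
  then have "z j \<in> {-1, 1}" "\<bar>p j\<bar> \<le> 1"
    using assms by (auto simp: cube_def PiE_iff)
  then show "(1 + p j * z j) / 2 \<ge> 0"
    by auto
qed

lemma sample_weight_nonneg:
  assumes "\<forall>j<d. \<bar>p j\<bar> \<le> 1" "S \<in> I \<rightarrow>\<^sub>E cube d"
  shows "sample_weight d p I S \<ge> 0"
  unfolding sample_weight_def using assms
  by (intro prod_nonneg ballI cube_weight_nonneg) (auto simp: PiE_iff)

text \<open>Independence of the coordinates, which is distributivity of products over sums. Total
  mass, means and moment generating functions are all obtained by choosing \<open>h\<close>.\<close>

lemma sum_cube_weight_prod:
  "(\<Sum>z\<in>cube d. cube_weight d p z * (\<Prod>j<d. h j (z j)))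
    = (\<Prod>j<d. (1 + p j) / 2 * h j 1 + (1 - p j) / 2 * h j (-1))"
proof -
  have "(\<Sum>z\<in>cube d. cube_weight d p z * (\<Prod>j<d. h j (z j)))
      = (\<Sum>z\<in>{..<d} \<rightarrow>\<^sub>E {-1, 1}. \<Prod>j<d. (1 + p j * z j) / 2 * h j (z j))"
    unfolding cube_def cube_weight_def by (simp only: prod.distrib)
  also have "\<dots> = (\<Prod>j<d. \<Sum>x\<in>{-1, 1}. (1 + p j * x) / 2 * h j x)"
    by (rule prod_sum_PiE [symmetric]) auto
  also have "\<dots> = (\<Prod>j<d. (1 + p j) / 2 * h j 1 + (1 - p j) / 2 * h j (-1))"
    by (intro prod.cong refl) simp
  finally show ?thesis .
qed

lemma sum_cube_weight: "(\<Sum>z\<in>cube d. cube_weight d p z) = 1"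
proof -
  have "(\<Sum>z\<in>cube d. cube_weight d p z) = (\<Prod>j<d. (1 + p j) / 2 + (1 - p j) / 2)"
    using sum_cube_weight_prod [of d p "\<lambda>_ _. 1"] by simp
  also have "\<dots> = 1"
    by (intro prod.neutral ballI) (simp add: field_simps)
  finally show ?thesis .
qed

lemma cube_mean:
  assumes "j < d"
  shows "(\<Sum>z\<in>cube d. cube_weight d p z * z j) = p j"
proof -
  have "(\<Sum>z\<in>cube d. cube_weight d p z * z j)
      = (\<Sum>z\<in>cube d. cube_weight d p z * (\<Prod>i<d. if i = j then z i else 1))"
    using assms by (simp add: prod.delta)
  also have "\<dots> = (\<Prod>i<d. (1 + p i) / 2 * (if i = j then 1 else 1)
      + (1 - p i) / 2 * (if i = j then - 1 else 1))"
    by (rule sum_cube_weight_prod)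
  also have "\<dots> = (\<Prod>i<d. if i = j then p j else 1)"
    by (intro prod.cong refl) (auto simp: field_simps)
  also have "\<dots> = p j"
    using assms by (simp add: prod.delta)
  finally show ?thesis .
qed

lemma sum_sample_weight_prod:
  assumes "finite I"
  shows "(\<Sum>S\<in>I \<rightarrow>\<^sub>E cube d. sample_weight d p I S * (\<Prod>i\<in>I. h i (S i)))
    = (\<Prod>i\<in>I. \<Sum>z\<in>cube d. cube_weight d p z * h i z)"
  unfolding sample_weight_def prod.distrib [symmetric]
  using assms by (intro prod_sum_PiE [symmetric]) auto

lemma sum_sample_weight:
  assumes "finite I"
  shows "(\<Sum>S\<in>I \<rightarrow>\<^sub>E cube d. sample_weight d p I S) = 1"
  using sum_sample_weight_prod [OF assms, of d p "\<lambda>_ _. 1"] by (simp add: sum_cube_weight)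

text \<open>Hoeffding's lemma for a centred sign, whose values lie in an interval of length 2. The
  logarithmic estimate for a Bernoulli variable with parameter \<open>q\<close>, taken at
  \<open>2 * \<eta>\<close>, is exponentiated.\<close>

lemma exp_two_point_le:
  fixes p \<eta> :: real
  assumes "\<bar>p\<bar> \<le> 1" "\<eta> \<ge> 0"
  shows "(1 + p) / 2 * exp (\<eta> * (1 - p)) + (1 - p) / 2 * exp (\<eta> * (- 1 - p)) \<le> exp (\<eta>\<^sup>2 / 2)"
proof -
  define q where "q = (1 + p) / 2"
  have q: "0 \<le> q"
    using assms by (simp add: q_def)
  have pos: "1 + q * (exp (2 * \<eta>) - 1) > 0"
    using q assms by (intro add_pos_nonneg mult_nonneg_nonneg) auto
  have "- (2 * \<eta>) * q + ln (1 + q * (exp (2 * \<eta>) - 1)) \<le> (2 * \<eta>)\<^sup>2 / 8"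
    using Hoeffdings_lemma_aux [of "2 * \<eta>" q] q assms by simp
  then have "exp (- (2 * \<eta>) * q + ln (1 + q * (exp (2 * \<eta>) - 1))) \<le> exp (\<eta>\<^sup>2 / 2)"
    by (simp add: power2_eq_square)
  also have "exp (- (2 * \<eta>) * q + ln (1 + q * (exp (2 * \<eta>) - 1)))
      = exp (- (2 * \<eta>) * q) * (1 + q * (exp (2 * \<eta>) - 1))"
    unfolding exp_add using pos by simp
  also have "\<dots> = q * (exp (- (2 * \<eta>) * q) * exp (2 * \<eta>)) + (1 - q) * exp (- (2 * \<eta>) * q)"
    by (simp add: algebra_simps)
  also have "exp (- (2 * \<eta>) * q) * exp (2 * \<eta>) = exp (\<eta> * (1 - p))"
    unfolding exp_add [symmetric] by (simp add: q_def field_simps)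
  also have "- (2 * \<eta>) * q = \<eta> * (- 1 - p)"
    by (simp add: q_def field_simps)
  finally show ?thesis
    by (simp add: q_def field_simps)
qed

lemma score_mgf:
  fixes \<eta> :: real
  assumes p: "\<forall>j<d. \<bar>p j\<bar> \<le> 1" and J: "J \<subseteq> {..<d}" and \<eta>: "\<eta> \<ge> 0"
  shows "(\<Sum>z\<in>cube d. cube_weight d p z * exp (\<eta> * score J p z)) \<le> exp (\<eta>\<^sup>2 * card J / 2)"
proof -
  let ?h = "\<lambda>j x. if j \<in> J then exp (\<eta> * (x - p j)) else 1"
  have "exp (\<eta> * score J p z) = (\<Prod>j<d. ?h j (z j))" for z
  proof -
    have "exp (\<eta> * score J p z) = (\<Prod>j\<in>J. exp (\<eta> * (z j - p j)))"
      using finite_subset [OF J] by (simp add: score_def sum_distrib_left exp_sum)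
    also have "\<dots> = (\<Prod>j<d. ?h j (z j))"
      using J by (intro prod.mono_neutral_cong_left) auto
    finally show ?thesis .
  qed
  then have "(\<Sum>z\<in>cube d. cube_weight d p z * exp (\<eta> * score J p z))
      = (\<Prod>j<d. (1 + p j) / 2 * ?h j 1 + (1 - p j) / 2 * ?h j (- 1))"
    using sum_cube_weight_prod [of d p ?h] by simp
  also have "\<dots> \<le> (\<Prod>j<d. if j \<in> J then exp (\<eta>\<^sup>2 / 2) else 1)"
  proof (rule prod_mono)
    fix j assume "j \<in> {..<d}"
    then have pj: "\<bar>p j\<bar> \<le> 1"
      using p by simp
    have "0 \<le> (1 + p j) / 2 * ?h j 1 + (1 - p j) / 2 * ?h j (- 1)"
      using pj by (intro add_nonneg_nonneg mult_nonneg_nonneg) auto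
    moreover have "(1 + p j) / 2 * ?h j 1 + (1 - p j) / 2 * ?h j (- 1)
        \<le> (if j \<in> J then exp (\<eta>\<^sup>2 / 2) else 1)"
      using exp_two_point_le [OF pj \<eta>] by (auto simp: field_simps)
    ultimately show "0 \<le> (1 + p j) / 2 * ?h j 1 + (1 - p j) / 2 * ?h j (- 1) \<and>
        (1 + p j) / 2 * ?h j 1 + (1 - p j) / 2 * ?h j (- 1)
          \<le> (if j \<in> J then exp (\<eta>\<^sup>2 / 2) else 1)"
      by blast
  qed
  also have "\<dots> = (\<Prod>j\<in>J. exp (\<eta>\<^sup>2 / 2))"
    using J by (intro prod.mono_neutral_cong_right) auto
  also have "\<dots> = exp (\<eta>\<^sup>2 * card J / 2)"
    by (simp add: exp_of_nat_mult [symmetric] field_simps)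
  finally show ?thesis .
qed

lemma score_tail:
  assumes p: "\<forall>j<d. \<bar>p j\<bar> \<le> 1" and J: "J \<subseteq> {..<d}" "card J > 0" and l: "l \<ge> 0"
  shows "(\<Sum>z\<in>cube d. cube_weight d p z * (if l \<le> score J p z then 1 else 0))
    \<le> exp (- (l\<^sup>2 / (2 * card J)))"
proof -
  \<comment> \<open>Minimiser of the Chernoff exponent \<eta>^2 |J| / 2 - \<eta> l.\<close>
  define \<eta> where "\<eta> = l / card J"
  have \<eta>: "\<eta> \<ge> 0"
    using l by (simp add: \<eta>_def)
  have "(\<Sum>z\<in>cube d. cube_weight d p z * (if l \<le> score J p z then 1 else 0))
      \<le> (\<Sum>z\<in>cube d. cube_weight d p z * (exp (\<eta> * score J p z) * exp (- \<eta> * l)))"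
  proof (intro sum_mono mult_left_mono cube_weight_nonneg p)
    fix z
    show "(if l \<le> score J p z then 1 else 0) \<le> exp (\<eta> * score J p z) * exp (- \<eta> * l)"
      using \<eta> by (auto simp: exp_add [symmetric] mult_left_mono)
  qed
  also have "\<dots> = (\<Sum>z\<in>cube d. cube_weight d p z * exp (\<eta> * score J p z)) * exp (- \<eta> * l)"
    by (simp add: sum_distrib_right mult.assoc)
  also have "\<dots> \<le> exp (\<eta>\<^sup>2 * card J / 2) * exp (- \<eta> * l)"
    by (intro mult_right_mono score_mgf p J \<eta>) auto
  also have "\<dots> = exp (- (l\<^sup>2 / (2 * card J)))"
    unfolding exp_add [symmetric] using J(2)
    by (simp add: \<eta>_def power2_eq_square field_simps)
  finally show ?thesis .
qed

text \<open>At the truncation level \<eta> |J| / 2 the damping exp (- \<eta> * level) cancels the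
  Hoeffding factor exp (\<eta>^2 |J| / 2) exactly. With exp (\<eta> * max 0 u) \<le> 1 + exp (\<eta>
  * u) every sample point then contributes a factor at most 2 \<le> e, and these factors multiply by
  independence.\<close>

lemma sum_exp_excess_le:
  fixes \<eta> :: real
  assumes p: "\<forall>j<d. \<bar>p j\<bar> \<le> 1" and J: "J \<subseteq> {..<d}" and I: "finite I" and \<eta>: "\<eta> \<ge> 0"
  shows "(\<Sum>S\<in>I \<rightarrow>\<^sub>E cube d. sample_weight d p I S *
      exp (\<eta> * (\<Sum>i\<in>I. max 0 (score J p (S i) - \<eta> * card J / 2)))) \<le> exp (card I)"
proof -
  let ?\<theta> = "\<eta> * card J / 2"
  let ?h = "\<lambda>z. exp (\<eta> * max 0 (score J p z - ?\<theta>))"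
  have "(\<Sum>S\<in>I \<rightarrow>\<^sub>E cube d. sample_weight d p I S *
      exp (\<eta> * (\<Sum>i\<in>I. max 0 (score J p (S i) - ?\<theta>))))
      = (\<Sum>S\<in>I \<rightarrow>\<^sub>E cube d. sample_weight d p I S * (\<Prod>i\<in>I. ?h (S i)))"
    using I by (simp add: sum_distrib_left exp_sum)
  also have "\<dots> = (\<Prod>i\<in>I. \<Sum>z\<in>cube d. cube_weight d p z * ?h z)"
    by (rule sum_sample_weight_prod [OF I])
  also have "\<dots> \<le> (\<Prod>i\<in>I. exp 1)"
  proof (intro prod_mono conjI sum_nonneg mult_nonneg_nonneg cube_weight_nonneg p)
    fix i
    have "(\<Sum>z\<in>cube d. cube_weight d p z * ?h z)
        \<le> (\<Sum>z\<in>cube d. cube_weight d p z * (1 + exp (\<eta> * score J p z) * exp (- \<eta> * ?\<theta>)))"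
    proof (intro sum_mono mult_left_mono cube_weight_nonneg p)
      fix z
      have "?h z \<le> 1 + exp (\<eta> * (score J p z - ?\<theta>))"
        by (auto simp: max_def)
      then show "?h z \<le> 1 + exp (\<eta> * score J p z) * exp (- \<eta> * ?\<theta>)"
        unfolding exp_add [symmetric] by (simp add: algebra_simps)
    qed
    also have "\<dots> = 1 + (\<Sum>z\<in>cube d. cube_weight d p z * exp (\<eta> * score J p z)) * exp (- \<eta> * ?\<theta>)"
      by (simp add: distrib_left sum.distrib sum_cube_weight sum_distrib_right mult.assoc)
    also have "\<dots> \<le> 1 + exp (\<eta>\<^sup>2 * card J / 2) * exp (- \<eta> * ?\<theta>)"
      by (intro add_left_mono mult_right_mono score_mgf p J \<eta>) auto
    also have "exp (\<eta>\<^sup>2 * card J / 2) * exp (- \<eta> * ?\<theta>) = 1"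
      unfolding exp_add [symmetric] by (simp add: power2_eq_square)
    also have "1 + 1 \<le> exp (1 :: real)"
      using exp_ge_add_one_self [of 1] by simp
    finally show "(\<Sum>z\<in>cube d. cube_weight d p z * ?h z) \<le> exp 1" .
  qed auto
  also have "\<dots> = exp (card I)"
    by (simp add: exp_of_nat_mult [symmetric])
  finally show ?thesis .
qed

text \<open>\<open>r S J\<close> stands for the probability that the estimate computed from
  \<open>S\<close> selects \<open>J\<close>. A score below \<open>l\<close> is charged
  \<open>l\<close>; a score from \<open>l\<close> on is charged the cap \<theta> = \<eta> s / 2 and
  is counted. What exceeds the cap is controlled simultaneously for all \<open>J\<close> in
  \<open>V\<close>, since the selection may depend on the sample; this produces the logarithm of
  \<open>card V\<close>.\<close>

lemma expected_total_score_le: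
  fixes \<eta> l :: real and r :: "(nat \<Rightarrow> nat \<Rightarrow> real) \<Rightarrow> nat set \<Rightarrow> real"
  assumes p: "\<forall>j<d. \<bar>p j\<bar> \<le> 1" and I: "finite I"
    and V: "finite V" "V \<noteq> {}" "\<And>J. J \<in> V \<Longrightarrow> J \<subseteq> {..<d} \<and> card J = s"
    and r: "\<And>S J. S \<in> I \<rightarrow>\<^sub>E cube d \<Longrightarrow> 0 \<le> r S J" 
      "\<And>S J. S \<in> I \<rightarrow>\<^sub>E cube d \<Longrightarrow> r S J \<le> 1"
      "\<And>S. S \<in> I \<rightarrow>\<^sub>E cube d \<Longrightarrow> (\<Sum>J\<in>V. r S J) = 1"
    and \<eta>: "\<eta> > 0" and l: "l \<ge> 0"
  shows "(\<Sum>S\<in>I \<rightarrow>\<^sub>E cube d. sample_weight d p I S * (\<Sum>J\<in>V. r S J * (\<Sum>i\<in>I. score J p (S i))))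
    \<le> card I * l
      + \<eta> * s / 2 * (\<Sum>S\<in>I \<rightarrow>\<^sub>E cube d. sample_weight d p I S *
          (\<Sum>J\<in>V. r S J * card {i \<in> I. l \<le> score J p (S i)}))
      + (ln (card V) + card I) / \<eta>"
proof -
  define E where "E f = (\<Sum>S\<in>I \<rightarrow>\<^sub>E cube d. sample_weight d p I S * (\<Sum>J\<in>V. r S J * f S J))"
    for f :: "(nat \<Rightarrow> nat \<Rightarrow> real) \<Rightarrow> nat set \<Rightarrow> real"
  have w0: "S \<in> I \<rightarrow>\<^sub>E cube d \<Longrightarrow> 0 \<le> sample_weight d p I S" for S
    using sample_weight_nonneg [of d p S I] p by auto
  have E_mono: "E f \<le> E g" if "\<And>S J. S \<in> I \<rightarrow>\<^sub>E cube d \<Longrightarrow> J \<in> V \<Longrightarrow> f S J \<le> g S J" for f g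
    unfolding E_def by (intro sum_mono mult_left_mono that w0 r)
  have E_add: "E (\<lambda>S J. f S J + g S J) = E f + E g" for f g
    by (simp add: E_def distrib_left sum.distrib)
  have E_cmult: "E (\<lambda>S J. c * f S J) = c * E f" for c f
    by (simp add: E_def sum_distrib_left mult_ac)
  have E_const: "E (\<lambda>_ _. c) = c" for c
    using r(3) sum_sample_weight [OF I, of d p]
    by (simp add: E_def sum_distrib_right [symmetric])
  define \<theta> where "\<theta> = \<eta> * s / 2"
  define Y where "Y S J = (\<Sum>i\<in>I. max 0 (score J p (S i) - \<theta>))" for S J
  \<comment> \<open>An upper bound for the expectation of exp (\<eta> Y) under the selection. With
    this normaliser the terms -1/\<eta> and 1/\<eta> cancel at the end, leaving ln M /
    \<eta>.\<close>
  define M where "M = card V * exp (card I)"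
  have cV: "card V > 0"
    using V by (simp add: card_gt_0_iff)
  then have M: "M > 0" "ln M = ln (card V) + card I"
    by (auto simp: M_def ln_mult)
  have "\<theta> \<ge> 0"
    using \<eta> by (simp add: \<theta>_def)
  have 1: "(\<Sum>i\<in>I. score J p (S i))
      \<le> (card I * l + \<theta> * card {i \<in> I. l \<le> score J p (S i)}) + Y S J" for S J
  proof -
    have "(\<Sum>i\<in>I. score J p (S i))
        \<le> (\<Sum>i\<in>I. l + \<theta> * (if l \<le> score J p (S i) then 1 else 0) + max 0 (score J p (S i) - \<theta>))"
      using l by (intro sum_mono) auto
    also have "\<dots> = (card I * l + \<theta> * card {i \<in> I. l \<le> score J p (S i)}) + Y S J"
      using I by (simp add: sum.distrib Y_def sum_distrib_left [symmetric] sum.If_cases Int_def)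
    finally show ?thesis .
  qed
  \<comment> \<open>\<open>ln u \<le> u - 1\<close> for \<open>u = exp (\<eta> y) / M\<close> replaces Jensen's inequality
    in the usual bound of the expectation of a maximum.\<close>
  have 2: "y \<le> (ln M - 1) / \<eta> + 1 / (\<eta> * M) * exp (\<eta> * y)" for y
  proof -
    have "ln (exp (\<eta> * y) / M) \<le> exp (\<eta> * y) / M - 1"
      using M by (intro ln_le_minus_one) auto
    then have "\<eta> * y \<le> ln M - 1 + exp (\<eta> * y) / M"
      using M by (simp add: ln_div)
    then have "y \<le> (ln M - 1 + exp (\<eta> * y) / M) / \<eta>"
      using \<eta> by (simp add: field_simps)
    then show ?thesis
      using \<eta> by (simp add: add_divide_distrib mult.commute)
  qed
  \<comment> \<open>The union bound: replacing the selection probability by 1 makes every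
    \<open>J\<close> a fixed set, to which the bound for independent points applies.\<close>
  have "E (\<lambda>S J. exp (\<eta> * Y S J))
      \<le> (\<Sum>S\<in>I \<rightarrow>\<^sub>E cube d. sample_weight d p I S * (\<Sum>J\<in>V. 1 * exp (\<eta> * Y S J)))"
    unfolding E_def by (intro sum_mono mult_left_mono mult_right_mono w0 r) auto
  also have "\<dots> = (\<Sum>J\<in>V. \<Sum>S\<in>I \<rightarrow>\<^sub>E cube d. sample_weight d p I S * exp (\<eta> * Y S J))"
    by (simp add: sum_distrib_left) (rule sum.swap)
  also have "\<dots> \<le> (\<Sum>J\<in>V. exp (card I))"
  proof (rule sum_mono)
    fix J assume "J \<in> V"
    then have J: "J \<subseteq> {..<d}" "card J = s"
      using V by auto
    show "(\<Sum>S\<in>I \<rightarrow>\<^sub>E cube d. sample_weight d p I S * exp (\<eta> * Y S J)) \<le> exp (card I)"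
      using sum_exp_excess_le [of d p J I \<eta>] p J I \<eta> by (simp add: Y_def \<theta>_def)
  qed
  finally have 3: "E (\<lambda>S J. exp (\<eta> * Y S J)) \<le> M"
    by (simp add: M_def)
  have "E (\<lambda>S J. \<Sum>i\<in>I. score J p (S i))
      \<le> E (\<lambda>S J. (card I * l + \<theta> * card {i \<in> I. l \<le> score J p (S i)})
        + ((ln M - 1) / \<eta> + 1 / (\<eta> * M) * exp (\<eta> * Y S J)))"
    by (intro E_mono order_trans [OF 1] add_left_mono 2)
  also have "\<dots> = card I * l + \<theta> * E (\<lambda>S J. card {i \<in> I. l \<le> score J p (S i)})
      + ((ln M - 1) / \<eta> + 1 / (\<eta> * M) * E (\<lambda>S J. exp (\<eta> * Y S J)))"
    by (simp only: E_add E_cmult E_const)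
  also have "\<dots> \<le> card I * l + \<theta> * E (\<lambda>S J. card {i \<in> I. l \<le> score J p (S i)})
      + ((ln M - 1) / \<eta> + 1 / (\<eta> * M) * M)"
    using 3 \<eta> M by (intro add_left_mono mult_left_mono) auto
  also have "(ln M - 1) / \<eta> + 1 / (\<eta> * M) * M = (ln (card V) + card I) / \<eta>"
    using M \<eta> by (simp add: field_simps)
  finally show ?thesis
    by (simp add: E_def \<theta>_def)
qed

section \<open>The conjugate prior on the mean\<close>

definition prior_mass :: "nat \<Rightarrow> real" where
  "prior_mass k = (\<integral>x. (1 - x\<^sup>2) ^ k * indicator {-1..1} x \<partial>lborel)"

text \<open>The Beta (k + 1, k + 1) law moved to [-1, 1], the conjugate prior for sign data. As the
  exponent is a natural number, the moment identities reduce to derivatives of polynomials.\<close>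

definition prior :: "nat \<Rightarrow> real measure" where
  "prior k = density lborel (\<lambda>x. ennreal ((1 - x\<^sup>2) ^ k * indicator {-1..1} x / prior_mass k))"

lemma integrable_Icc_continuous:
  fixes f :: "real \<Rightarrow> real"
  assumes "\<And>x. isCont f x"
  shows "integrable lborel (\<lambda>x. f x * indicator {a..b} x)"
  using borel_integrable_atLeastAtMost [of a b f] assms by (simp add: indicator_times_eq_if mult.commute
    if_distrib cong: if_cong)

lemma prior_weight_nonneg: "0 \<le> (1 - x\<^sup>2) ^ k * indicator {-1..1} (x :: real)"
  by (auto simp: indicator_def abs_square_le_1 abs_le_iff)

lemma prior_mass_pos: "prior_mass k > 0"
proof -
  have "(\<integral>x. (3 / 4 :: real) ^ k * indicator {-1/2..1/2} (x :: real) \<partial>lborel) \<le> prior_mass k"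
    unfolding prior_mass_def
  proof (rule integral_mono)
    fix x :: real
    show "(3 / 4) ^ k * indicator {-1/2..1/2} x \<le> (1 - x\<^sup>2) ^ k * indicator {-1..1} x"
    proof (cases "x \<in> {-1/2..1/2}")
      case True
      then have "x\<^sup>2 \<le> (1/2)\<^sup>2"
        by (subst abs_le_square_iff [symmetric]) auto
      then have "3 / 4 \<le> 1 - x\<^sup>2"
        by (simp add: power2_eq_square)
      with True show ?thesis
        by (auto simp: indicator_def intro!: power_mono)
    qed (use prior_weight_nonneg in auto)
  qed (auto intro!: integrable_Icc_continuous continuous_intros)
  moreover have "(\<integral>x. (3 / 4 :: real) ^ k * indicator {-1/2..1/2} (x :: real) \<partial>lborel) > 0"
    by simp
  ultimately show ?thesis
    by linarith
qed

lemma sets_prior [measurable_cong, simp]: "sets (prior k) = sets borel"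
  and space_prior [simp]: "space (prior k) = UNIV"
  by (simp_all add: prior_def)

lemma integral_prior:
  fixes f :: "real \<Rightarrow> real"
  assumes [measurable]: "f \<in> borel_measurable borel"
  shows "integral\<^sup>L (prior k) f
    = (\<integral>x. f x * (1 - x\<^sup>2) ^ k * indicator {-1..1} x \<partial>lborel) / prior_mass k"
proof -
  have "integral\<^sup>L (prior k) f
      = (\<integral>x. ((1 - x\<^sup>2) ^ k * indicator {-1..1} x / prior_mass k) *\<^sub>R f x \<partial>lborel)"
    unfolding prior_def using prior_mass_pos [of k]
    by (intro integral_density) (auto intro!: AE_I2 divide_nonneg_pos prior_weight_nonneg)
  also have "\<dots> = (\<integral>x. f x * (1 - x\<^sup>2) ^ k * indicator {-1..1} x / prior_mass k \<partial>lborel)"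
    by (simp add: mult_ac)
  finally show ?thesis
    by simp
qed

lemma prob_space_prior: "prob_space (prior k)"
proof (rule prob_spaceI)
  have "emeasure (prior k) (space (prior k))
      = (\<integral>\<^sup>+x. ennreal ((1 - x\<^sup>2) ^ k * indicator {-1..1} x / prior_mass k) \<partial>lborel)"
    by (simp add: prior_def emeasure_density)
  also have "\<dots> = ennreal (\<integral>x. (1 - x\<^sup>2) ^ k * indicator {-1..1} x / prior_mass k \<partial>lborel)"
    using prior_mass_pos [of k]
    by (intro nn_integral_eq_integral integrable_divide_zero integrable_Icc_continuous AE_I2
        divide_nonneg_pos prior_weight_nonneg) (auto intro!: continuous_intros)
  also have "\<dots> = 1"
    using prior_mass_pos [of k] by (simp add: prior_mass_def [symmetric])
  finally show "emeasure (prior k) (space (prior k)) = 1" .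
qed

lemma AE_prior: "AE x in prior k. \<bar>x\<bar> \<le> 1"
  unfolding prior_def by (subst AE_density) (auto intro!: AE_I2 simp: indicator_def)

lemma integrable_prior:
  fixes f :: "real \<Rightarrow> real"
  assumes [measurable]: "f \<in> borel_measurable borel" and "\<And>x. \<bar>x\<bar> \<le> 1 \<Longrightarrow> \<bar>f x\<bar> \<le> B"
  shows "integrable (prior k) f"
proof -
  interpret prob_space "prior k" by (rule prob_space_prior)
  show ?thesis
    by (rule integrable_const_bound [of _ B]) (use assms(2) in \<open>auto intro: eventually_mono [OF AE_prior]\<close>)
qed

lemma integrable_prior_continuous:
  fixes f :: "real \<Rightarrow> real"
  assumes "continuous_on UNIV f"
  shows "integrable (prior k) f"
proof -
  have "compact (f ` {-1..1})"
    using assms by (intro compact_continuous_image) (auto intro: continuous_on_subset)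
  then obtain B where "\<forall>y \<in> f ` {-1..1}. norm y \<le> B"
    using compact_imp_bounded bounded_iff by blast
  then show ?thesis
    using assms by (intro integrable_prior [of _ B] borel_measurable_continuous_onI)
      (auto simp: abs_le_iff)
qed

text \<open>Integration by parts in the form used throughout: \<open>f\<close> times the weight is
  the derivative of \<open>g\<close>. In the applications \<open>g\<close> carries the factor
  \<open>(1 - x\<^sup>2) ^ Suc k\<close>, which vanishes at both endpoints.\<close>

lemma integral_prior_eq_0:
  fixes f g :: "real \<Rightarrow> real"
  assumes der: "\<And>x. (g has_real_derivative f x * (1 - x\<^sup>2) ^ k) (at x)"
    and "g 1 = g (-1)" and "continuous_on UNIV f"
  shows "integral\<^sup>L (prior k) f = 0"
proof -
  have "(\<integral>x. f x * (1 - x\<^sup>2) ^ k * indicator {-1..1} x \<partial>lborel) = g 1 - g (-1)"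
    using assms by (intro integral_FTC_Icc_real)
      (auto intro!: continuous_intros simp: continuous_on_eq_continuous_at)
  then show ?thesis
    using assms by (simp add: integral_prior borel_measurable_continuous_onI)
qed

lemma has_derivative_prior_weight:
  "((\<lambda>x::real. (1 - x\<^sup>2) ^ Suc k) has_real_derivative - (2 * (real k + 1) * x * (1 - x\<^sup>2) ^ k)) (at x)"
proof -
  have "((\<lambda>x::real. 1 - x\<^sup>2) has_real_derivative - (2 * x)) (at x)"
    by (auto intro!: derivative_eq_intros)
  from DERIV_power_Suc [OF this, of k] show ?thesis
    by (simp add: algebra_simps)
qed

text \<open>Conjugacy: after \<open>n\<close> signs \<open>x i\<close> with mean \<open>p\<close>, the posterior mean of \<open>p\<close>
  is \<open>(\<Sum>i. x i) / (n + 2 (real k + 1))\<close>.\<close>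

lemma prior_conjugate:
  fixes x :: "'i \<Rightarrow> real"
  assumes "finite I" and x: "\<And>i. i \<in> I \<Longrightarrow> x i \<in> {-1, 1}"
  shows "(\<integral>p. (\<Prod>i\<in>I. (1 + p * x i) / 2) * ((\<Sum>i\<in>I. x i) - (real (card I) + 2 * (real k + 1)) * p) \<partial>prior k) = 0"
proof -
  define P where "P p = (\<Prod>i\<in>I. (1 + p * x i) / 2)" for p
  \<comment> \<open>The score identity of the likelihood, multiplied by 1 - p^2 so that nothing is
    divided by 1 + p x at the endpoints. For a sign x it rests on x (1 - p^2) = (1 + p x) (x - p),
    as x^2 = 1.\<close>
  have "\<exists>Q. \<forall>p::real. (P has_real_derivative Q p) (at p) \<and>
      Q p * (1 - p\<^sup>2) = P p * ((\<Sum>i\<in>I. x i) - card I * p)"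
    using assms unfolding P_def
  proof (induction I rule: finite_induct)
    case empty
    show ?case
      by (intro exI [of _ "\<lambda>_. 0"]) auto
  next
    case (insert i I)
    then obtain Q where Q: "\<And>p::real. ((\<lambda>p. \<Prod>i\<in>I. (1 + p * x i) / 2) has_real_derivative Q p) (at p)"
      "\<And>p::real. Q p * (1 - p\<^sup>2) = (\<Prod>i\<in>I. (1 + p * x i) / 2) * ((\<Sum>i\<in>I. x i) - card I * p)"
      by auto
    let ?P = "\<lambda>p. \<Prod>i\<in>I. (1 + p * x i) / 2"
    show ?case
    proof (intro exI [of _ "\<lambda>p. x i / 2 * ?P p + (1 + p * x i) / 2 * Q p"] allI conjI)
      fix p
      have "((\<lambda>p. (1 + p * x i) / 2 * ?P p) has_real_derivative
          x i / 2 * ?P p + (1 + p * x i) / 2 * Q p) (at p)"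
        by (auto intro!: derivative_eq_intros Q(1))
      then show "((\<lambda>p. \<Prod>i\<in>insert i I. (1 + p * x i) / 2) has_real_derivative
          x i / 2 * ?P p + (1 + p * x i) / 2 * Q p) (at p)"
        using insert by simp
      have "x i = 1 \<or> x i = - 1"
        using insert by auto
      then have *: "x i * (1 - p\<^sup>2) = (1 + p * x i) * (x i - p)"
        by (auto simp: power2_eq_square algebra_simps)
      have aux: "(a / 2 * b + c / 2 * e) * f = c / 2 * b * ((a - p) + g)"
        if "a * f = c * (a - p)" "e * f = b * g" for a b c e f g :: real
      proof -
        have "(a / 2 * b + c / 2 * e) * f = b / 2 * (a * f) + c / 2 * (e * f)"
          by (simp add: algebra_simps)
        then show ?thesis
          unfolding that by (simp add: algebra_simps)
      qed
      have "(x i / 2 * ?P p + (1 + p * x i) / 2 * Q p) * (1 - p\<^sup>2)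
          = (1 + p * x i) / 2 * ?P p * ((x i - p) + ((\<Sum>i\<in>I. x i) - card I * p))"
        by (rule aux [OF * Q(2)])
      also have "\<dots> = (\<Prod>i\<in>insert i I. (1 + p * x i) / 2) * ((\<Sum>i\<in>insert i I. x i) - card (insert i I) * p)"
        using insert by (simp add: algebra_simps)
      finally show "(x i / 2 * ?P p + (1 + p * x i) / 2 * Q p) * (1 - p\<^sup>2) = \<dots>" .
    qed
  qed
  then obtain Q where Q: "\<And>p::real. (P has_real_derivative Q p) (at p)"
    "\<And>p::real. Q p * (1 - p\<^sup>2) = P p * ((\<Sum>i\<in>I. x i) - card I * p)"
    by auto
  show ?thesis
    unfolding P_def [symmetric]
  proof (rule integral_prior_eq_0)
    fix p :: real
    have "((\<lambda>p. P p * (1 - p\<^sup>2) ^ Suc k) has_real_derivative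
        Q p * (1 - p\<^sup>2) ^ Suc k - P p * (2 * (real k + 1) * p * (1 - p\<^sup>2) ^ k)) (at p)"
      using DERIV_mult' [OF Q(1) [of p] has_derivative_prior_weight [of k p]] by (simp add: algebra_simps)
    also have "Q p * (1 - p\<^sup>2) ^ Suc k - P p * (2 * (real k + 1) * p * (1 - p\<^sup>2) ^ k)
        = (Q p * (1 - p\<^sup>2)) * (1 - p\<^sup>2) ^ k - P p * (2 * (real k + 1) * p * (1 - p\<^sup>2) ^ k)"
      by simp
    also have "\<dots> = P p * ((\<Sum>i\<in>I. x i) - (real (card I) + 2 * (real k + 1)) * p) * (1 - p\<^sup>2) ^ k"
      unfolding Q(2) by (simp add: algebra_simps)
    finally show "((\<lambda>p. P p * (1 - p\<^sup>2) ^ Suc k) has_real_derivative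
        P p * ((\<Sum>i\<in>I. x i) - (real (card I) + 2 * (real k + 1)) * p) * (1 - p\<^sup>2) ^ k) (at p)" .
    show "continuous_on UNIV (\<lambda>p. P p * ((\<Sum>i\<in>I. x i) - (real (card I) + 2 * (real k + 1)) * p))"
      unfolding P_def by (intro continuous_intros) auto
  qed simp
qed

text \<open>The function \<open>1 - (2 * real k + 3) * x\<^sup>2\<close> times the weight is the
  derivative of \<open>x * (1 - x\<^sup>2) ^ Suc k\<close>.\<close>

lemma prior_second_moment: "(\<integral>x. x\<^sup>2 \<partial>prior k) = 1 / (2 * real k + 3)"
proof -
  interpret prob_space "prior k" by (rule prob_space_prior)
  have "(\<integral>x. 1 - (2 * real k + 3) * x\<^sup>2 \<partial>prior k) = 0"
  proof (rule integral_prior_eq_0)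
    fix x :: real
    have "((\<lambda>x. x * (1 - x\<^sup>2) ^ Suc k) has_real_derivative
        (1 - x\<^sup>2) ^ Suc k - x * (2 * (real k + 1) * x * (1 - x\<^sup>2) ^ k)) (at x)"
      using DERIV_mult' [OF DERIV_ident [of "at x"] has_derivative_prior_weight [of k x]]
      by (simp add: algebra_simps)
    also have "(1 - x\<^sup>2) ^ Suc k - x * (2 * (real k + 1) * x * (1 - x\<^sup>2) ^ k)
        = (1 - (2 * real k + 3) * x\<^sup>2) * (1 - x\<^sup>2) ^ k"
      by (simp add: algebra_simps power2_eq_square)
    finally show "((\<lambda>x. x * (1 - x\<^sup>2) ^ Suc k) has_real_derivative
        (1 - (2 * real k + 3) * x\<^sup>2) * (1 - x\<^sup>2) ^ k) (at x)" .
  qed (auto intro!: continuous_intros)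
  moreover have "(\<integral>x. 1 - (2 * real k + 3) * x\<^sup>2 \<partial>prior k) = 1 - (2 * real k + 3) * (\<integral>x. x\<^sup>2 \<partial>prior k)"
    using prob_space by (subst Bochner_Integration.integral_diff)
      (auto intro!: integrable_prior_continuous continuous_intros)
  ultimately show ?thesis
    by (simp add: field_simps)
qed

text \<open>The inequality 2 t |x| \<le> t^2 + x^2 combined with the second moment; \<open>t\<close>
  is taken as \<alpha> later, the scale on which this error has to be small.\<close>

lemma prior_abs_moment_le:
  assumes "t > 0"
  shows "(\<integral>x. \<bar>x\<bar> \<partial>prior k) \<le> (t + 1 / (t * (2 * real k + 3))) / 2"
proof -
  interpret prob_space "prior k" by (rule prob_space_prior)
  have "(\<integral>x. \<bar>x\<bar> \<partial>prior k) \<le> (\<integral>x. t / 2 + x\<^sup>2 * (1 / (2 * t)) \<partial>prior k)"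
  proof (rule integral_mono)
    fix x :: real
    have "0 \<le> (t - \<bar>x\<bar>)\<^sup>2"
      by simp
    then have "2 * t * \<bar>x\<bar> \<le> t\<^sup>2 + x\<^sup>2"
      by (simp add: power2_eq_square algebra_simps)
    then show "\<bar>x\<bar> \<le> t / 2 + x\<^sup>2 * (1 / (2 * t))"
      using assms by (simp add: field_simps power2_eq_square)
  qed (use assms in \<open>auto intro!: integrable_prior_continuous continuous_intros\<close>)
  also have "\<dots> = t / 2 + (1 / (2 * real k + 3)) * (1 / (2 * t))"
    using prob_space assms by (subst Bochner_Integration.integral_add)
      (auto intro!: integrable_prior_continuous continuous_intros simp: prior_second_moment)
  also have "\<dots> = (t + 1 / (t * (2 * real k + 3))) / 2"
    by (simp add: add_divide_distrib mult_ac)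
  finally show ?thesis
    by simp
qed

text \<open>The last hypothesis and Chebyshev's inequality put at least half of the mass into
  [-\<alpha>, \<alpha>], where the unnormalised density is at most 1, so \<open>prior_mass k\<close>
  is at most 4 \<alpha>. On [3 \<alpha>, 4 \<alpha>], an interval of length \<alpha> inside [-1, 1],
  that density is at least \<open>(1 - 16 * \<alpha>\<^sup>2) ^ k\<close>. The two factors \<alpha>
  cancel.\<close>

lemma prior_tail_ge:
  assumes \<alpha>: "\<alpha> > 0" "4 * \<alpha> \<le> 1" "(2 * real k + 3) * \<alpha>\<^sup>2 \<ge> 2"
  shows "(1 - 16 * \<alpha>\<^sup>2) ^ k / 4 \<le> (\<integral>x. indicator {3 * \<alpha>..} x \<partial>prior k)"
proof -
  let ?w = "\<lambda>x::real. (1 - x\<^sup>2) ^ k * indicator {-1..1} x"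
  have [simp]: "integrable lborel ?w" "integrable lborel (\<lambda>x. x\<^sup>2 * ?w x)"
    unfolding mult.assoc [symmetric]
    by (auto intro!: integrable_Icc_continuous continuous_intros)
  have "prior_mass k \<le> (\<integral>x. indicator {-\<alpha>..\<alpha>} x + x\<^sup>2 * ?w x * (1 / \<alpha>\<^sup>2) \<partial>lborel)"
    unfolding prior_mass_def
  proof (rule integral_mono)
    fix x :: real
    show "?w x \<le> indicator {-\<alpha>..\<alpha>} x + x\<^sup>2 * ?w x * (1 / \<alpha>\<^sup>2)"
    proof (cases "x \<in> {-\<alpha>..\<alpha>}")
      case True
      have "?w x \<le> 1"
        by (auto simp: indicator_def abs_square_le_1 abs_le_iff intro!: power_le_one)
      moreover have "0 \<le> x\<^sup>2 * ?w x * (1 / \<alpha>\<^sup>2)"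
        by (intro mult_nonneg_nonneg [OF mult_nonneg_nonneg] prior_weight_nonneg) auto
      ultimately show ?thesis
        using True by simp
    next
      case False
      then have "\<alpha>\<^sup>2 \<le> x\<^sup>2"
        using \<alpha> by (subst abs_le_square_iff [symmetric]) auto
      then have "?w x * 1 \<le> ?w x * (x\<^sup>2 / \<alpha>\<^sup>2)"
        using \<alpha> prior_weight_nonneg [of x k] by (intro mult_left_mono) auto
      then show ?thesis
        using False by (simp add: mult_ac)
    qed
  qed (auto intro!: integrable_real_indicator simp: emeasure_lborel_Icc_eq)
  also have "\<dots> = 2 * \<alpha> + (\<integral>x. x\<^sup>2 * ?w x \<partial>lborel) * (1 / \<alpha>\<^sup>2)"
    using \<alpha> by (subst Bochner_Integration.integral_add)
      (auto intro!: integrable_real_indicator simp: emeasure_lborel_Icc_eq)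
  also have "(\<integral>x. x\<^sup>2 * ?w x \<partial>lborel) = prior_mass k / (2 * real k + 3)"
    using prior_second_moment [of k] prior_mass_pos [of k]
    by (subst (asm) integral_prior) (auto simp: field_simps)
  also have "prior_mass k / (2 * real k + 3) * (1 / \<alpha>\<^sup>2) \<le> prior_mass k / 2"
  proof -
    have "prior_mass k / ((2 * real k + 3) * \<alpha>\<^sup>2) \<le> prior_mass k / 2"
      using \<alpha> prior_mass_pos [of k] by (intro divide_left_mono) auto
    then show ?thesis
      by simp
  qed
  finally have Z: "prior_mass k \<le> 4 * \<alpha>"
    by simp
  have "\<alpha> * (1 - 16 * \<alpha>\<^sup>2) ^ k = (\<integral>x. (1 - 16 * \<alpha>\<^sup>2) ^ k * indicator {3 * \<alpha>..4 * \<alpha>} x \<partial>lborel)"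
    using \<alpha> by simp
  also have "\<dots> \<le> (\<integral>x. indicator {3 * \<alpha>..} x * ?w x \<partial>lborel)"
  proof (rule integral_mono)
    fix x :: real
    show "(1 - 16 * \<alpha>\<^sup>2) ^ k * indicator {3 * \<alpha>..4 * \<alpha>} x \<le> indicator {3 * \<alpha>..} x * ?w x"
    proof (cases "x \<in> {3 * \<alpha>..4 * \<alpha>}")
      case True
      then have "x\<^sup>2 \<le> (4 * \<alpha>)\<^sup>2" "(4 * \<alpha>)\<^sup>2 \<le> 1\<^sup>2"
        using \<alpha> by (intro power_mono; simp)+
      then have "(1 - 16 * \<alpha>\<^sup>2) ^ k \<le> (1 - x\<^sup>2) ^ k"
        by (intro power_mono) (auto simp: power2_eq_square)
      with True \<alpha> show ?thesis
        by (auto simp: indicator_def)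
    next
      case False
      then show ?thesis
        using prior_weight_nonneg [of x k] by simp
    qed
  next
    show "integrable lborel (\<lambda>x. indicator {3 * \<alpha>..} x * ?w x)"
      using integrable_mult_indicator [of "{3 * \<alpha>..}" lborel ?w] by simp
  qed (use \<alpha> in \<open>auto intro!: integrable_real_indicator simp: emeasure_lborel_Icc_eq\<close>)
  finally have "\<alpha> * (1 - 16 * \<alpha>\<^sup>2) ^ k / prior_mass k
      \<le> (\<integral>x. indicator {3 * \<alpha>..} x * ?w x \<partial>lborel) / prior_mass k"
    using prior_mass_pos [of k] by (intro divide_right_mono) auto
  also have "\<dots> = (\<integral>x. indicator {3 * \<alpha>..} x \<partial>prior k)"
    by (subst integral_prior) (simp_all add: mult.assoc)
  finally have 1: "\<alpha> * (1 - 16 * \<alpha>\<^sup>2) ^ k / prior_mass k \<le> (\<integral>x. indicator {3 * \<alpha>..} x \<partial>prior k)" .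
  have "(4 * \<alpha>)\<^sup>2 \<le> 1\<^sup>2"
    using \<alpha> by (intro power_mono) auto
  then have "0 \<le> \<alpha> * (1 - 16 * \<alpha>\<^sup>2) ^ k"
    using \<alpha> by (intro mult_nonneg_nonneg zero_le_power) (auto simp: power2_eq_square)
  then have "\<alpha> * (1 - 16 * \<alpha>\<^sup>2) ^ k / (4 * \<alpha>) \<le> \<alpha> * (1 - 16 * \<alpha>\<^sup>2) ^ k / prior_mass k"
    using Z \<alpha> prior_mass_pos [of k] by (intro divide_left_mono) auto
  with 1 have "\<alpha> * (1 - 16 * \<alpha>\<^sup>2) ^ k / (4 * \<alpha>) \<le> (\<integral>x. indicator {3 * \<alpha>..} x \<partial>prior k)"
    by (rule order_trans [rotated])
  with \<alpha> show ?thesis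
    by simp
qed

section \<open>Independent prior means for all coordinates\<close>

definition prior_PiM :: "nat \<Rightarrow> nat \<Rightarrow> (nat \<Rightarrow> real) measure" where
  "prior_PiM d k = PiM {..<d} (\<lambda>_. prior k)"

lemma prob_space_prior_PiM: "prob_space (prior_PiM d k)"
  unfolding prior_PiM_def by (intro prob_space_PiM prob_space_prior)

lemma measurable_prior_PiM_component:
  assumes "j < d"
  shows "(\<lambda>p. p j) \<in> borel_measurable (prior_PiM d k)"
proof -
  have "(\<lambda>p. p j) \<in> prior_PiM d k \<rightarrow>\<^sub>M prior k"
    unfolding prior_PiM_def using assms by (intro measurable_component_singleton) auto
  then show ?thesis
    by (simp cong: measurable_cong_sets)
qed

lemma AE_prior_PiM: "AE p in prior_PiM d k. \<forall>j<d. \<bar>p j\<bar> \<le> 1"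
proof -
  have "AE p in prior_PiM d k. \<forall>j\<in>{..<d}. \<bar>p j\<bar> \<le> 1"
    unfolding prior_PiM_def
    by (intro AE_finite_allI finite_lessThan AE_PiM_component prob_space_prior AE_prior)
  then show ?thesis
    by (rule eventually_mono) auto
qed

lemma integrable_prior_PiM:
  fixes f :: "(nat \<Rightarrow> real) \<Rightarrow> real"
  assumes "f \<in> borel_measurable (prior_PiM d k)"
    and "\<And>p. \<forall>j<d. \<bar>p j\<bar> \<le> 1 \<Longrightarrow> \<bar>f p\<bar> \<le> B"
  shows "integrable (prior_PiM d k) f"
proof -
  interpret prob_space "prior_PiM d k" by (rule prob_space_prior_PiM)
  show ?thesis
    by (rule integrable_const_bound [of _ B])
      (use assms in \<open>auto intro: eventually_mono [OF AE_prior_PiM]\<close>)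
qed

lemma integral_prior_PiM_prod:
  assumes "\<And>j. j < d \<Longrightarrow> integrable (prior k) (h j)"
  shows "integrable (prior_PiM d k) (\<lambda>p. \<Prod>j<d. h j (p j))"
    and "(\<integral>p. (\<Prod>j<d. h j (p j)) \<partial>prior_PiM d k) = (\<Prod>j<d. \<integral>x. h j x \<partial>prior k :: real)"
proof -
  interpret product_sigma_finite "\<lambda>_::nat. prior k"
    by (simp add: product_sigma_finite_def prob_space_imp_sigma_finite prob_space_prior)
  show "integrable (prior_PiM d k) (\<lambda>p. \<Prod>j<d. h j (p j))"
    unfolding prior_PiM_def using assms by (intro product_integrable_prod) auto
  show "(\<integral>p. (\<Prod>j<d. h j (p j)) \<partial>prior_PiM d k) = (\<Prod>j<d. \<integral>x. h j x \<partial>prior k)"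
    unfolding prior_PiM_def using assms by (intro product_integral_prod) auto
qed

lemma integral_prior_PiM_component:
  fixes h :: "real \<Rightarrow> real"
  assumes "j < d" "integrable (prior k) h"
  shows "integrable (prior_PiM d k) (\<lambda>p. h (p j))"
    and "(\<integral>p. h (p j) \<partial>prior_PiM d k) = (\<integral>x. h x \<partial>prior k)"
proof -
  interpret prob_space "prior k" by (rule prob_space_prior)
  let ?h = "\<lambda>i x. if i = j then h x else 1"
  have int: "integrable (prior k) (?h i)" for i
    using assms by (cases "i = j") simp_all
  have eq: "h (p j) = (\<Prod>i<d. ?h i (p i))" for p :: "nat \<Rightarrow> real"
    using assms by (simp add: prod.delta)
  show "integrable (prior_PiM d k) (\<lambda>p. h (p j))"
    unfolding eq by (rule integral_prior_PiM_prod [OF int])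
  have "(\<integral>p. h (p j) \<partial>prior_PiM d k) = (\<Prod>i<d. \<integral>x. ?h i x \<partial>prior k)"
    unfolding eq by (rule integral_prior_PiM_prod [OF int])
  also have "\<dots> = (\<Prod>i<d. if i = j then \<integral>x. h x \<partial>prior k else 1)"
    using prob_space by (intro prod.cong refl) auto
  also have "\<dots> = (\<integral>x. h x \<partial>prior k)"
    using assms by (simp add: prod.delta)
  finally show "(\<integral>p. h (p j) \<partial>prior_PiM d k) = (\<integral>x. h x \<partial>prior k)" .
qed

text \<open>For a fixed sample the likelihood factorises over the coordinates, and the factor of
  coordinate \<open>j\<close> has prior integral 0 by one-dimensional conjugacy.\<close>

lemma sample_weight_prior_conjugate:
  assumes I: "finite I" and S: "S \<in> I \<rightarrow>\<^sub>E cube d" and j: "j < d"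
  shows "integrable (prior_PiM d k)
      (\<lambda>p. sample_weight d p I S * ((\<Sum>i\<in>I. S i j) - (real (card I) + 2 * (real k + 1)) * p j))" (is ?int)
    and "(\<integral>p. sample_weight d p I S * ((\<Sum>i\<in>I. S i j) - (real (card I) + 2 * (real k + 1)) * p j)
      \<partial>prior_PiM d k) = 0" (is ?eq)
proof -
  let ?h = "\<lambda>j' x::real. (\<Prod>i\<in>I. (1 + x * S i j') / 2) *
    (if j' = j then (\<Sum>i\<in>I. S i j) - (real (card I) + 2 * (real k + 1)) * x else 1)"
  have int: "integrable (prior k) (?h j')" for j'
    by (cases "j' = j") (auto intro!: integrable_prior_continuous continuous_intros)
  have eq: "sample_weight d p I S * ((\<Sum>i\<in>I. S i j) - (real (card I) + 2 * (real k + 1)) * p j)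
      = (\<Prod>j'<d. ?h j' (p j'))" for p
  proof -
    have "sample_weight d p I S = (\<Prod>j'<d. \<Prod>i\<in>I. (1 + p j' * S i j') / 2)"
      unfolding sample_weight_def cube_weight_def by (rule prod.swap)
    then show ?thesis
      using j by (simp add: prod.distrib prod.delta)
  qed
  show ?int
    unfolding eq by (rule integral_prior_PiM_prod [OF int])
  have "(\<integral>p. (\<Prod>j'<d. ?h j' (p j')) \<partial>prior_PiM d k) = (\<Prod>j'<d. \<integral>x. ?h j' x \<partial>prior k)"
    by (rule integral_prior_PiM_prod [OF int])
  also have "\<dots> = 0"
  proof (rule prod_zero)
    have "S i j \<in> {-1, 1}" if "i \<in> I" for i
      using S j that by (auto simp: PiE_iff cube_def)
    then show "\<exists>j'\<in>{..<d}. (\<integral>x. ?h j' x \<partial>prior k) = 0"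
      using prior_conjugate [OF I, of "\<lambda>i. S i j" k] j by (intro bexI [of _ j]) auto
  qed simp
  finally show ?eq
    unfolding eq .
qed

lemma abs_Max_image_le:
  fixes p :: "'i \<Rightarrow> real"
  assumes "finite B" "B \<noteq> {}" "\<And>j. j \<in> B \<Longrightarrow> \<bar>p j\<bar> \<le> c"
  shows "\<bar>Max (p ` B)\<bar> \<le> c"
proof -
  have "Max (p ` B) \<in> p ` B"
    using assms by (intro Max_in) auto
  then obtain j where "j \<in> B" "Max (p ` B) = p j"
    by auto
  with assms show ?thesis
    by simp
qed

text \<open>If some mean in \<open>B\<close> reaches \<open>a\<close>, the maximum is at least
  \<open>a\<close>; otherwise it is still at least - |p j| for any fixed \<open>j\<close> in
  \<open>B\<close>. Subtracting |p j| in both cases gives one integrand whose expectation is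
  computed from independence and the first absolute moment.\<close>

lemma prior_PiM_Max_ge:
  assumes B: "B \<subseteq> {..<d}" "B \<noteq> {}" and a: "a \<ge> 0"
  shows "integrable (prior_PiM d k) (\<lambda>p. Max (p ` B))"
    and "a * (1 - (1 - (\<integral>x. indicator {a..} x \<partial>prior k)) ^ card B) - (\<integral>x. \<bar>x\<bar> \<partial>prior k)
      \<le> (\<integral>p. Max (p ` B) \<partial>prior_PiM d k)"
proof -
  interpret prob_space "prior_PiM d k" by (rule prob_space_prior_PiM)
  interpret P: prob_space "prior k" by (rule prob_space_prior)
  have fB: "finite B"
    using B finite_subset by blast
  show int: "integrable (prior_PiM d k) (\<lambda>p. Max (p ` B))"
  proof (rule integrable_prior_PiM)
    show "(\<lambda>p. Max (p ` B)) \<in> borel_measurable (prior_PiM d k)"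
      using fB B by (intro borel_measurable_Max measurable_prior_PiM_component) auto
    show "\<bar>Max (p ` B)\<bar> \<le> 1" if "\<forall>j<d. \<bar>p j\<bar> \<le> 1" for p :: "nat \<Rightarrow> real"
      using that fB B by (intro abs_Max_image_le) auto
  qed
  obtain j where j: "j \<in> B" "j < d"
    using B by auto
  let ?h = "\<lambda>i x::real. if i \<in> B then 1 - indicator {a..} x else 1 :: real"
  have h: "integrable (prior k) (?h i)" for i
  proof -
    have "integrable (prior k) (\<lambda>x. 1 - indicator {a..} x :: real)"
    proof (rule integrable_prior)
      show "(\<lambda>x. 1 - indicator {a..} x :: real) \<in> borel_measurable borel"
        by (intro borel_measurable_diff borel_measurable_const borel_measurable_indicator) simp
      show "\<bar>1 - indicator {a..} x :: real\<bar> \<le> 1" for x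
        by (simp add: indicator_def)
    qed
    then show ?thesis
      by (cases "i \<in> B") simp_all
  qed
  have j_abs: "integrable (prior_PiM d k) (\<lambda>p. \<bar>p j\<bar>)"
    "(\<integral>p. \<bar>p j\<bar> \<partial>prior_PiM d k) = (\<integral>x. \<bar>x\<bar> \<partial>prior k)"
    using integral_prior_PiM_component [OF j(2), of k abs]
    by (simp_all add: integrable_prior_continuous continuous_intros)
  \<comment> \<open>The product is the indicator of the event that no mean in \<open>B\<close>
    reaches \<open>a\<close>.\<close>
  have "(\<integral>p. (\<Prod>i<d. ?h i (p i)) \<partial>prior_PiM d k) = (\<Prod>i<d. \<integral>x. ?h i x \<partial>prior k)"
    by (rule integral_prior_PiM_prod [OF h])
  also have "\<dots> = (\<Prod>i<d. if i \<in> B then 1 - (\<integral>x. indicator {a..} x \<partial>prior k) else 1)"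
  proof (rule prod.cong [OF refl])
    fix i
    have "(\<integral>x. 1 - indicator {a..} x \<partial>prior k) = 1 - (\<integral>x. indicator {a..} x \<partial>prior k :: real)"
      using P.prob_space by (subst Bochner_Integration.integral_diff)
        (auto intro!: integrable_real_indicator simp: P.emeasure_eq_measure)
    then show "(\<integral>x. ?h i x \<partial>prior k) = (if i \<in> B then 1 - (\<integral>x. indicator {a..} x \<partial>prior k) else 1)"
      using P.prob_space by auto
  qed
  also have "\<dots> = (\<Prod>i\<in>B. 1 - (\<integral>x. indicator {a..} x \<partial>prior k))"
    using B by (intro prod.mono_neutral_cong_right) auto
  finally have prod: "(\<integral>p. (\<Prod>i<d. ?h i (p i)) \<partial>prior_PiM d k)
      = (1 - (\<integral>x. indicator {a..} x \<partial>prior k)) ^ card B"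
    by simp
  have "a * (1 - (1 - (\<integral>x. indicator {a..} x \<partial>prior k)) ^ card B) - (\<integral>x. \<bar>x\<bar> \<partial>prior k)
      = (\<integral>p. a * (1 - (\<Prod>i<d. ?h i (p i))) - \<bar>p j\<bar> \<partial>prior_PiM d k)"
    using integral_prior_PiM_prod(1) [OF h, of d] j_abs prob_space unfolding prod [symmetric]
    by (simp add: Bochner_Integration.integral_diff)
  also have "\<dots> \<le> (\<integral>p. Max (p ` B) \<partial>prior_PiM d k)"
  proof (rule integral_mono [OF _ int])
    show "integrable (prior_PiM d k) (\<lambda>p. a * (1 - (\<Prod>i<d. ?h i (p i))) - \<bar>p j\<bar>)"
      using integral_prior_PiM_prod(1) [OF h, of d] j_abs by simp
    fix p :: "nat \<Rightarrow> real"
    show "a * (1 - (\<Prod>i<d. ?h i (p i))) - \<bar>p j\<bar> \<le> Max (p ` B)"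
    proof (cases "\<exists>i\<in>B. a \<le> p i")
      case True
      then obtain i where i: "i \<in> B" "a \<le> p i" by auto
      then have zero: "(\<Prod>i<d. ?h i (p i)) = 0"
        using B by (intro prod_zero) (auto intro!: bexI [of _ i])
      have "a \<le> Max (p ` B)"
        using i fB by (intro order_trans [OF i(2)] Max_ge) auto
      then show ?thesis
        unfolding zero by simp
    next
      case False
      then have one: "(\<Prod>i<d. ?h i (p i)) = 1"
        by (intro prod.neutral) (auto simp: indicator_def)
      have "p j \<le> Max (p ` B)"
        using j fB by simp
      then show ?thesis
        unfolding one by simp
    qed
  qed
  finally show "a * (1 - (1 - (\<integral>x. indicator {a..} x \<partial>prior k)) ^ card B) - (\<integral>x. \<bar>x\<bar> \<partial>prior k)
      \<le> (\<integral>p. Max (p ` B) \<partial>prior_PiM d k)" .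
qed

text \<open>The total score splits into \<open>D p\<close>, whose prior mean is 0 by conjugacy, and
  2 (k + 1) times the expected sum \<open>e p\<close> of the selected means. The selection
  \<open>r\<close> depends on the sample only and not on \<open>p\<close>, so it is a constant
  inside the prior integral. Some \<open>p\<close> must reach the prior average of the total
  score.\<close>

lemma exists_mean_large_total_score:
  fixes r :: "(nat \<Rightarrow> nat \<Rightarrow> real) \<Rightarrow> nat set \<Rightarrow> real" and B :: "nat \<Rightarrow> nat set"
  assumes I: "finite I" and V: "finite V" "\<And>J. J \<in> V \<Longrightarrow> J \<subseteq> {..<d}"
    and B: "\<And>t. t < s \<Longrightarrow> B t \<subseteq> {..<d}" "\<And>t. t < s \<Longrightarrow> B t \<noteq> {}"
    and Max: "\<And>t. t < s \<Longrightarrow> 2 * \<alpha> \<le> (\<integral>p. Max (p ` B t) \<partial>prior_PiM d k)"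
    and acc: "\<And>p. \<forall>j<d. \<bar>p j\<bar> \<le> 1 \<Longrightarrow> (\<Sum>t<s. Max (p ` B t)) - s * \<alpha>
      \<le> (\<Sum>S\<in>I \<rightarrow>\<^sub>E cube d. sample_weight d p I S * (\<Sum>J\<in>V. r S J * (\<Sum>j\<in>J. p j)))"
  shows "\<exists>p. (\<forall>j<d. \<bar>p j\<bar> \<le> 1) \<and> 2 * (real k + 1) * \<alpha> * s
    \<le> (\<Sum>S\<in>I \<rightarrow>\<^sub>E cube d. sample_weight d p I S * (\<Sum>J\<in>V. r S J * (\<Sum>i\<in>I. score J p (S i))))"
proof (rule ccontr)
  interpret prob_space "prior_PiM d k" by (rule prob_space_prior_PiM)
  define T where "T p = (\<Sum>S\<in>I \<rightarrow>\<^sub>E cube d. sample_weight d p I S *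
    (\<Sum>J\<in>V. r S J * (\<Sum>i\<in>I. score J p (S i))))" for p
  define e where "e p = (\<Sum>S\<in>I \<rightarrow>\<^sub>E cube d. sample_weight d p I S * (\<Sum>J\<in>V. r S J * (\<Sum>j\<in>J. p j)))" for p
  define D where "D p = (\<Sum>S\<in>I \<rightarrow>\<^sub>E cube d. \<Sum>J\<in>V. \<Sum>j\<in>J. r S J *
    (sample_weight d p I S * ((\<Sum>i\<in>I. S i j) - (real (card I) + 2 * (real k + 1)) * p j)))" for p
  assume "\<not> ?thesis"
  then have T_less: "T p < 2 * (real k + 1) * \<alpha> * s" if "\<forall>j<d. \<bar>p j\<bar> \<le> 1" for p
    using that by (force simp: T_def not_le)
  have T: "T p = D p + 2 * (real k + 1) * e p" for p
  proof -
    have "(\<Sum>i\<in>I. score J p (S i))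
        = (\<Sum>j\<in>J. (\<Sum>i\<in>I. S i j) - (real (card I) + 2 * (real k + 1)) * p j) + 2 * (real k + 1) * (\<Sum>j\<in>J. p j)" for J S
    proof -
      have "(\<Sum>i\<in>I. score J p (S i)) = (\<Sum>j\<in>J. \<Sum>i\<in>I. S i j - p j)"
        unfolding score_def by (rule sum.swap)
      also have "\<dots> = (\<Sum>j\<in>J. ((\<Sum>i\<in>I. S i j) - (real (card I) + 2 * (real k + 1)) * p j) + 2 * (real k + 1) * p j)"
        by (simp add: sum_subtractf algebra_simps)
      also have "\<dots> = (\<Sum>j\<in>J. (\<Sum>i\<in>I. S i j) - (real (card I) + 2 * (real k + 1)) * p j) + 2 * (real k + 1) * (\<Sum>j\<in>J. p j)"
        by (simp only: sum.distrib sum_distrib_left)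
      finally show ?thesis .
    qed
    then show ?thesis
      unfolding T_def D_def e_def
      by (simp only: distrib_left sum.distrib sum_distrib_left mult.left_commute mult.assoc)
  qed
  have D_int: "integrable (prior_PiM d k) D" and D0: "(\<integral>p. D p \<partial>prior_PiM d k) = 0"
  proof -
    define g where "g S J j p = r S J *
      (sample_weight d p I S * ((\<Sum>i\<in>I. S i j) - (real (card I) + 2 * (real k + 1)) * p j))" for S J j p
    have g: "integrable (prior_PiM d k) (g S J j)" "(\<integral>p. g S J j p \<partial>prior_PiM d k) = 0"
      if "S \<in> I \<rightarrow>\<^sub>E cube d" "J \<in> V" "j \<in> J" for S J j
    proof -
      have "j < d"
        using V that by auto
      note * = sample_weight_prior_conjugate [OF I that(1) this, of k]
      show "integrable (prior_PiM d k) (g S J j)" "(\<integral>p. g S J j p \<partial>prior_PiM d k) = 0"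
        unfolding g_def using * by simp_all
    qed
    have D: "D p = (\<Sum>S\<in>I \<rightarrow>\<^sub>E cube d. \<Sum>J\<in>V. \<Sum>j\<in>J. g S J j p)" for p
      by (simp add: D_def g_def)
    show "integrable (prior_PiM d k) D"
      unfolding D by (intro Bochner_Integration.integrable_sum g)
    show "(\<integral>p. D p \<partial>prior_PiM d k) = 0"
      unfolding D using g
      by (simp add: Bochner_Integration.integral_sum Bochner_Integration.integrable_sum)
  qed
  have meas [measurable]: "e \<in> borel_measurable (prior_PiM d k)"
    unfolding e_def sample_weight_def cube_weight_def
    using V by (intro borel_measurable_sum borel_measurable_times borel_measurable_prod
        borel_measurable_divide borel_measurable_add borel_measurable_const
        measurable_prior_PiM_component) auto
  have e_int: "integrable (prior_PiM d k) e"
  proof (rule integrable_prior_PiM [OF meas])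
    fix p :: "nat \<Rightarrow> real" assume p: "\<forall>j<d. \<bar>p j\<bar> \<le> 1"
    have "\<bar>e p\<bar> \<le> (\<Sum>S\<in>I \<rightarrow>\<^sub>E cube d. \<bar>sample_weight d p I S * (\<Sum>J\<in>V. r S J * (\<Sum>j\<in>J. p j))\<bar>)"
      unfolding e_def by (rule sum_abs)
    also have "\<dots> \<le> (\<Sum>S\<in>I \<rightarrow>\<^sub>E cube d. 1 * (\<Sum>J\<in>V. \<bar>r S J\<bar> * card J))"
    proof (rule sum_mono)
      fix S assume S: "S \<in> I \<rightarrow>\<^sub>E cube d"
      have 1: "0 \<le> sample_weight d p I S"
        using S p by (intro sample_weight_nonneg) auto
      have "sample_weight d p I S \<le> (\<Sum>S\<in>I \<rightarrow>\<^sub>E cube d. sample_weight d p I S)"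
        using S p I by (intro member_le_sum sample_weight_nonneg) auto
      then have 2: "sample_weight d p I S \<le> 1"
        using I by (simp add: sum_sample_weight)
      have "\<bar>\<Sum>J\<in>V. r S J * (\<Sum>j\<in>J. p j)\<bar> \<le> (\<Sum>J\<in>V. \<bar>r S J * (\<Sum>j\<in>J. p j)\<bar>)"
        by (rule sum_abs)
      also have "\<dots> \<le> (\<Sum>J\<in>V. \<bar>r S J\<bar> * card J)"
        unfolding abs_mult
      proof (intro sum_mono mult_left_mono)
        fix J assume "J \<in> V"
        then have "\<bar>p j\<bar> \<le> 1" if "j \<in> J" for j
          using V p that by auto
        then have "(\<Sum>j\<in>J. \<bar>p j\<bar>) \<le> (\<Sum>j\<in>J. 1)"
          by (intro sum_mono) auto
        then show "\<bar>\<Sum>j\<in>J. p j\<bar> \<le> card J"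
          by (intro order_trans [OF sum_abs]) simp
      qed auto
      finally show "\<bar>sample_weight d p I S * (\<Sum>J\<in>V. r S J * (\<Sum>j\<in>J. p j))\<bar>
          \<le> 1 * (\<Sum>J\<in>V. \<bar>r S J\<bar> * card J)"
        unfolding abs_mult using 1 2 by (intro mult_mono) auto
    qed
    finally show "\<bar>e p\<bar> \<le> (\<Sum>S\<in>I \<rightarrow>\<^sub>E cube d. 1 * (\<Sum>J\<in>V. \<bar>r S J\<bar> * card J))" .
  qed
  have T_int: "integrable (prior_PiM d k) T"
    unfolding T using D_int e_int by simp
  have M_int: "integrable (prior_PiM d k) (\<lambda>p. Max (p ` B t))" if "t < s" for t
    using prior_PiM_Max_ge(1) [of "B t" d 0 k] B [OF that] by simp
  have MS_int: "integrable (prior_PiM d k) (\<lambda>p. \<Sum>t<s. Max (p ` B t))"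
    by (intro Bochner_Integration.integrable_sum M_int) simp
  \<comment> \<open>Every block maximum averages at least 2 \<alpha>, and the selection loses at
    most \<alpha> per block.\<close>
  have "s * \<alpha> = (\<Sum>t<s. 2 * \<alpha>) - s * \<alpha>"
    by simp
  also have "\<dots> \<le> (\<Sum>t<s. \<integral>p. Max (p ` B t) \<partial>prior_PiM d k) - s * \<alpha>"
    using Max by (intro diff_right_mono sum_mono) auto
  also have "\<dots> = (\<integral>p. (\<Sum>t<s. Max (p ` B t)) - s * \<alpha> \<partial>prior_PiM d k)"
    using M_int MS_int prob_space
    by (subst Bochner_Integration.integral_diff) (simp_all add: Bochner_Integration.integral_sum)
  also have "\<dots> \<le> (\<integral>p. e p \<partial>prior_PiM d k)"
    using MS_int acc
    by (intro integral_mono_AE e_int eventually_mono [OF AE_prior_PiM])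
      (auto simp: e_def)
  finally have "2 * (real k + 1) * (s * \<alpha>) \<le> 2 * (real k + 1) * (\<integral>p. e p \<partial>prior_PiM d k)"
    by (intro mult_left_mono) auto
  also have "\<dots> = (\<integral>p. T p \<partial>prior_PiM d k)"
    unfolding T using D_int e_int D0 by simp
  also have "\<dots> < 2 * (real k + 1) * \<alpha> * s"
    using T_int T_less by (intro expectation_less eventually_mono [OF AE_prior_PiM]) auto
  finally show False
    by (simp add: mult_ac)
qed

section \<open>From estimators to finite sums\<close>

definition cube_law :: "nat \<Rightarrow> (nat \<Rightarrow> real) \<Rightarrow> (nat \<Rightarrow> real) measure" where
  "cube_law d p = point_measure (cube d) (\<lambda>z. ennreal (cube_weight d p z))"

lemma sign_cube_eq: "sign_cube d = count_space (cube d)"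
  by (simp add: sign_cube_def cube_def)

lemma cube_law_in_prob_algebra:
  assumes "\<forall>j<d. \<bar>p j\<bar> \<le> 1"
  shows "cube_law d p \<in> space (prob_algebra (sign_cube d))"
proof -
  have "emeasure (cube_law d p) (space (cube_law d p)) = 1"
    using assms by (simp add: cube_law_def space_point_measure emeasure_point_measure_finite
        sum_ennreal cube_weight_nonneg sum_cube_weight)
  then have "prob_space (cube_law d p)"
    by (rule prob_spaceI)
  then show ?thesis
    by (simp add: space_prob_algebra sign_cube_eq cube_law_def sets_point_measure)
qed

lemma integral_cube_law_component:
  assumes "\<forall>j<d. \<bar>p j\<bar> \<le> 1" "j < d"
  shows "(\<integral>z. z j \<partial>cube_law d p) = p j"
  using assms cube_mean [of j d p]
  by (simp add: cube_law_def lebesgue_integral_point_measure_finite cube_weight_nonneg)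

text \<open>This turns every integral over samples into a finite sum against
  \<open>sample_weight\<close>, the form in which the score bounds are stated.\<close>

lemma PiM_cube_law:
  assumes p: "\<forall>j<d. \<bar>p j\<bar> \<le> 1" and I: "finite I"
  shows "PiM (I :: nat set) (\<lambda>_. cube_law d p)
    = point_measure (I \<rightarrow>\<^sub>E cube d) (\<lambda>S. ennreal (sample_weight d p I S))"
proof -
  have ps: "prob_space (cube_law d p)"
    using cube_law_in_prob_algebra [OF p] by (simp add: space_prob_algebra)
  then interpret product_sigma_finite "\<lambda>_. cube_law d p"
    by (simp add: product_sigma_finite_def prob_space_imp_sigma_finite)
  have "sets (PiM I (\<lambda>_. cube_law d p)) = sets (PiM I (\<lambda>_. count_space (cube d)))"
    by (intro sets_PiM_cong) (auto simp: cube_law_def sets_point_measure)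
  also have "\<dots> = Pow (I \<rightarrow>\<^sub>E cube d)"
    using I by (subst count_space_PiM_finite) (auto simp: countable_finite)
  finally have sets: "sets (PiM I (\<lambda>_. cube_law d p)) = Pow (I \<rightarrow>\<^sub>E cube d)" .
  show ?thesis
  proof (rule PiM_eqI [OF I, symmetric])
    fix X :: "nat \<Rightarrow> (nat \<Rightarrow> real) set" assume "\<And>i. i \<in> I \<Longrightarrow> X i \<in> sets (cube_law d p)"
    then have X: "\<And>i. i \<in> I \<Longrightarrow> X i \<subseteq> cube d"
      by (auto simp: cube_law_def sets_point_measure)
    then have fX: "\<And>i. i \<in> I \<Longrightarrow> finite (X i)"
      using finite_subset [OF X finite_cube] by blast
    have sub: "Pi\<^sub>E I X \<subseteq> I \<rightarrow>\<^sub>E cube d"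
      using X by (rule PiE_mono)
    have "emeasure (point_measure (I \<rightarrow>\<^sub>E cube d) (\<lambda>S. ennreal (sample_weight d p I S))) (Pi\<^sub>E I X)
        = (\<Sum>S\<in>Pi\<^sub>E I X. ennreal (sample_weight d p I S))"
      using I sub by (simp add: emeasure_point_measure_finite)
    also have "\<dots> = (\<Sum>S\<in>Pi\<^sub>E I X. \<Prod>i\<in>I. ennreal (cube_weight d p (S i)))"
      unfolding sample_weight_def
    proof (intro sum.cong refl prod_ennreal [symmetric] cube_weight_nonneg p)
      fix S i assume "S \<in> Pi\<^sub>E I X" "i \<in> I"
      then show "S i \<in> cube d"
        using X by (auto simp: PiE_iff)
    qed
    also have "\<dots> = (\<Prod>i\<in>I. \<Sum>z\<in>X i. ennreal (cube_weight d p z))"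
      using fX I by (intro prod_sum_PiE [symmetric])
    also have "\<dots> = (\<Prod>i\<in>I. emeasure (cube_law d p) (X i))"
      using X by (intro prod.cong refl) (simp add: cube_law_def emeasure_point_measure_finite)
    finally show "emeasure (point_measure (I \<rightarrow>\<^sub>E cube d) (\<lambda>S. ennreal (sample_weight d p I S))) (Pi\<^sub>E I X)
        = (\<Prod>i\<in>I. emeasure (cube_law d p) (X i))" .
  qed (simp add: sets sets_point_measure)
qed

lemma nn_integral_PiM_cube_law:
  fixes I :: "nat set"
  assumes "\<forall>j<d. \<bar>p j\<bar> \<le> 1" and "finite I"
  shows "(\<integral>\<^sup>+S. f S \<partial>PiM I (\<lambda>_. cube_law d p))
    = (\<Sum>S\<in>I \<rightarrow>\<^sub>E cube d. ennreal (sample_weight d p I S) * f S)"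
  using assms by (simp add: PiM_cube_law nn_integral_point_measure_finite)

lemma sets_PiM_cube_law:
  fixes I :: "nat set"
  assumes "\<forall>j<d. \<bar>p j\<bar> \<le> 1" and "finite I"
  shows "sets (PiM I (\<lambda>_. cube_law d p)) = Pow (I \<rightarrow>\<^sub>E cube d)"
  using assms by (simp add: PiM_cube_law sets_point_measure)

lemma space_PiM_cube_law:
  fixes I :: "nat set"
  assumes "\<forall>j<d. \<bar>p j\<bar> \<le> 1" and "finite I"
  shows "space (PiM I (\<lambda>_. cube_law d p)) = I \<rightarrow>\<^sub>E cube d"
  using assms by (simp add: PiM_cube_law space_point_measure)

lemma estimator_sign_cubeD:
  assumes "estimator (sign_cube d) d' n A" "S \<in> {1..n} \<rightarrow>\<^sub>E cube d"
  shows "prob_space (A S)" "sets (A S) = sets (Rd d')" "space (A S) = space (Rd d')"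
proof -
  have "A S \<in> space (prob_algebra (Rd d'))"
    using assms by (simp add: estimator_sign_cube_iff cube_def)
  then show "prob_space (A S)" and sets: "sets (A S) = sets (Rd d')"
    by (auto simp: space_prob_algebra)
  from sets show "space (A S) = space (Rd d')"
    by (rule sets_eq_imp_space_eq)
qed

lemma measurable_estimator:
  assumes "estimator Z d n A" "sets D = sets Z"
  shows "A \<in> PiM {1..n} (\<lambda>_. D) \<rightarrow>\<^sub>M prob_algebra (Rd d)"
proof -
  have "sets (PiM {1..n} (\<lambda>_. D)) = sets (PiM {1..n} (\<lambda>_. Z))"
    by (intro sets_PiM_cong) (auto simp: assms)
  then show ?thesis
    using assms(1) measurable_cong_sets [OF _ refl] unfolding estimator_def by blast
qed

lemma sets_cube_law: "sets (cube_law d p) = sets (sign_cube d)"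
  by (simp add: sign_cube_eq cube_law_def sets_point_measure)

section \<open>Integrals against the estimate and the tracing law\<close>

lemma nn_integral_estimate_law:
  assumes p: "\<forall>j<d. \<bar>p j\<bar> \<le> 1" and A: "estimator (sign_cube d) d n A"
    and f: "f \<in> borel_measurable (Rd d)"
  shows "(\<integral>\<^sup>+\<mu>. f \<mu> \<partial>estimate_law n A (cube_law d p))
    = (\<Sum>S\<in>{1..n} \<rightarrow>\<^sub>E cube d. ennreal (sample_weight d p {1..n} S) * (\<integral>\<^sup>+\<mu>. f \<mu> \<partial>A S))"
proof -
  have "A \<in> PiM {1..n} (\<lambda>_. cube_law d p) \<rightarrow>\<^sub>M subprob_algebra (Rd d)"
    using measurable_estimator [OF A sets_cube_law] by (rule measurable_prob_algebraD)
  then show ?thesis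
    unfolding estimate_law_def
    by (simp add: nn_integral_bind [OF f] nn_integral_PiM_cube_law [OF p])
qed

lemma nn_integral_tracing_law:
  assumes p: "\<forall>j<d. \<bar>p j\<bar> \<le> 1" and A: "estimator (sign_cube d) d n A"
    and f: "f \<in> borel_measurable (PiM {0..n} (\<lambda>_. cube_law d p) \<Otimes>\<^sub>M Rd d)"
  shows "(\<integral>\<^sup>+x. f x \<partial>tracing_law d n A (cube_law d p))
    = (\<Sum>T\<in>{0..n} \<rightarrow>\<^sub>E cube d. ennreal (sample_weight d p {0..n} T) *
        (\<integral>\<^sup>+\<mu>. f (T, \<mu>) \<partial>A (restrict T {1..n})))"
proof -
  define P where "P = PiM {0..n} (\<lambda>_. cube_law d p)"
  have [measurable]: "A \<in> PiM {1..n} (\<lambda>_. cube_law d p) \<rightarrow>\<^sub>M prob_algebra (Rd d)"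
    by (rule measurable_estimator [OF A sets_cube_law])
  have [measurable]: "(\<lambda>S. restrict S {1..n}) \<in> P \<rightarrow>\<^sub>M PiM {1..n} (\<lambda>_. cube_law d p)"
    unfolding P_def by (intro measurable_restrict_subset) auto
  define K where "K = (\<lambda>S. A (restrict S {1..n}) \<bind> (\<lambda>\<mu>. return (P \<Otimes>\<^sub>M Rd d) (S, \<mu>)))"
  have "K \<in> P \<rightarrow>\<^sub>M prob_algebra (P \<Otimes>\<^sub>M Rd d)"
    unfolding K_def by (rule measurable_bind_prob_space2 [where N = "Rd d"]) measurable
  then have K: "K \<in> P \<rightarrow>\<^sub>M subprob_algebra (P \<Otimes>\<^sub>M Rd d)"
    by (rule measurable_prob_algebraD)
  have f': "f \<in> borel_measurable (P \<Otimes>\<^sub>M Rd d)"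
    using f by (simp add: P_def)
  have spP: "space P = {0..n} \<rightarrow>\<^sub>E cube d"
    unfolding P_def by (rule space_PiM_cube_law [OF p]) auto
  have inner: "(\<integral>\<^sup>+x. f x \<partial>K T) = (\<integral>\<^sup>+\<mu>. f (T, \<mu>) \<partial>A (restrict T {1..n}))"
    if T: "T \<in> {0..n} \<rightarrow>\<^sub>E cube d" for T
  proof -
    have T': "restrict T {1..n} \<in> {1..n} \<rightarrow>\<^sub>E cube d"
      using T by (auto simp: PiE_iff)
    note AT = estimator_sign_cubeD [OF A T']
    have "(\<lambda>\<mu>. return (P \<Otimes>\<^sub>M Rd d) (T, \<mu>)) \<in> Rd d \<rightarrow>\<^sub>M subprob_algebra (P \<Otimes>\<^sub>M Rd d)"
      using T by (intro measurable_compose [OF measurable_Pair1' return_measurable]) (simp add: spP)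
    then have R: "(\<lambda>\<mu>. return (P \<Otimes>\<^sub>M Rd d) (T, \<mu>))
        \<in> A (restrict T {1..n}) \<rightarrow>\<^sub>M subprob_algebra (P \<Otimes>\<^sub>M Rd d)"
      unfolding measurable_cong_sets [OF AT(2) refl] .
    have "(\<integral>\<^sup>+x. f x \<partial>K T)
        = (\<integral>\<^sup>+\<mu>. \<integral>\<^sup>+x. f x \<partial>return (P \<Otimes>\<^sub>M Rd d) (T, \<mu>) \<partial>A (restrict T {1..n}))"
      unfolding K_def by (rule nn_integral_bind [OF f' R])
    also have "\<dots> = (\<integral>\<^sup>+\<mu>. f (T, \<mu>) \<partial>A (restrict T {1..n}))"
      using T AT(3) f' by (intro nn_integral_cong nn_integral_return) (auto simp: space_pair_measure spP)
    finally show ?thesis .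
  qed
  have "(\<integral>\<^sup>+x. f x \<partial>tracing_law d n A (cube_law d p)) = (\<integral>\<^sup>+x. f x \<partial>(P \<bind> K))"
    by (simp add: tracing_law_def K_def P_def)
  also have "\<dots> = (\<integral>\<^sup>+T. \<integral>\<^sup>+x. f x \<partial>K T \<partial>P)"
    by (rule nn_integral_bind [OF f' K])
  also have "\<dots> = (\<Sum>T\<in>{0..n} \<rightarrow>\<^sub>E cube d. ennreal (sample_weight d p {0..n} T) * (\<integral>\<^sup>+x. f x \<partial>K T))"
    unfolding P_def by (rule nn_integral_PiM_cube_law [OF p]) auto
  finally show ?thesis
    by (simp add: inner)
qed

text \<open>The estimate enters the argument only through a statistic with finitely many values.
  These probabilities instantiate the selection weights \<open>r S J\<close> of the score
  bounds.\<close>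

definition statistic_law ::
    "nat \<Rightarrow> ('s \<Rightarrow> (nat \<Rightarrow> real) measure) \<Rightarrow> ((nat \<Rightarrow> real) \<Rightarrow> 'x) \<Rightarrow> 's \<Rightarrow> 'x \<Rightarrow> real" where
  "statistic_law d A J S X = measure (A S) {\<mu> \<in> space (Rd d). J \<mu> = X}"

lemma statistic_law_bounds:
  assumes "estimator (sign_cube d) d n A" "S \<in> {1..n} \<rightarrow>\<^sub>E cube d"
  shows "0 \<le> statistic_law d A J S X" "statistic_law d A J S X \<le> 1"
proof -
  interpret prob_space "A S" by (rule estimator_sign_cubeD [OF assms])
  show "0 \<le> statistic_law d A J S X" "statistic_law d A J S X \<le> 1"
    by (auto simp: statistic_law_def)
qed

lemma nn_integral_statistic:
  assumes A: "estimator (sign_cube d) d n A" and S: "S \<in> {1..n} \<rightarrow>\<^sub>E cube d"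
    and J: "J \<in> Rd d \<rightarrow>\<^sub>M count_space V" and V: "finite V"
    and g: "\<And>X. X \<in> V \<Longrightarrow> 0 \<le> g X"
  shows "(\<integral>\<^sup>+\<mu>. ennreal (g (J \<mu>)) \<partial>A S) = ennreal (\<Sum>X\<in>V. statistic_law d A J S X * g X)"
proof -
  interpret prob_space "A S" by (rule estimator_sign_cubeD [OF A S])
  note AS = estimator_sign_cubeD [OF A S]
  have JV: "J \<mu> \<in> V" if "\<mu> \<in> space (Rd d)" for \<mu>
    using measurable_space [OF J that] by simp
  have sets: "{\<mu> \<in> space (Rd d). J \<mu> = X} \<in> sets (A S)" for X
  proof -
    have "{\<mu> \<in> space (Rd d). J \<mu> = X} = J -` ({X} \<inter> V) \<inter> space (Rd d)"
      using JV by auto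
    also have "\<dots> \<in> sets (Rd d)"
      using J by (rule measurable_sets) auto
    finally show ?thesis
      using AS by simp
  qed
  have "(\<integral>\<^sup>+\<mu>. ennreal (g (J \<mu>)) \<partial>A S)
      = (\<integral>\<^sup>+\<mu>. (\<Sum>X\<in>V. ennreal (g X) * indicator {\<mu> \<in> space (Rd d). J \<mu> = X} \<mu>) \<partial>A S)"
  proof (rule nn_integral_cong)
    fix \<mu> assume "\<mu> \<in> space (A S)"
    then have \<mu>: "\<mu> \<in> space (Rd d)"
      using AS by simp
    have "(\<Sum>X\<in>V. ennreal (g X) * indicator {\<mu> \<in> space (Rd d). J \<mu> = X} \<mu>)
        = (\<Sum>X\<in>V. if X = J \<mu> then ennreal (g X) else 0)"
      using \<mu> by (intro sum.cong refl) auto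
    also have "\<dots> = ennreal (g (J \<mu>))"
      using JV [OF \<mu>] V by simp
    finally show "ennreal (g (J \<mu>))
        = (\<Sum>X\<in>V. ennreal (g X) * indicator {\<mu> \<in> space (Rd d). J \<mu> = X} \<mu>)" ..
  qed
  also have "\<dots> = (\<Sum>X\<in>V. ennreal (g X) * emeasure (A S) {\<mu> \<in> space (Rd d). J \<mu> = X})"
    using sets by (subst nn_integral_sum) (auto simp: nn_integral_cmult_indicator)
  also have "\<dots> = (\<Sum>X\<in>V. ennreal (statistic_law d A J S X * g X))"
    using g by (intro sum.cong refl)
      (simp add: statistic_law_def emeasure_eq_measure ennreal_mult mult.commute)
  also have "\<dots> = ennreal (\<Sum>X\<in>V. statistic_law d A J S X * g X)"
    using g by (intro sum_ennreal mult_nonneg_nonneg statistic_law_bounds [OF A S]) auto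
  finally show ?thesis .
qed

lemma sum_statistic_law:
  assumes A: "estimator (sign_cube d) d n A" and S: "S \<in> {1..n} \<rightarrow>\<^sub>E cube d"
    and J: "J \<in> Rd d \<rightarrow>\<^sub>M count_space V" and V: "finite V"
  shows "(\<Sum>X\<in>V. statistic_law d A J S X) = 1"
proof -
  interpret prob_space "A S" by (rule estimator_sign_cubeD [OF A S])
  have "ennreal (\<Sum>X\<in>V. statistic_law d A J S X) = 1"
    using nn_integral_statistic [OF A S J V, of "\<lambda>_. 1"] by (simp add: emeasure_space_1)
  then show ?thesis
    by simp
qed

text \<open>Covers both tracing conditions: \<open>g\<close> is an indicator involving
  \<open>T 0\<close> for the false positives and a count over the sample for the traced points. The
  estimate sees only the restriction of \<open>T\<close> to the indices from 1.\<close>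

lemma nn_integral_tracing_law_statistic:
  assumes p: "\<forall>j<d. \<bar>p j\<bar> \<le> 1" and A: "estimator (sign_cube d) d n A"
    and J: "J \<in> Rd d \<rightarrow>\<^sub>M count_space V" and V: "finite V"
    and g: "\<And>T X. X \<in> V \<Longrightarrow> 0 \<le> g T X"
  shows "(\<lambda>x. g (fst x) (J (snd x))) \<in> borel_measurable (PiM {0..n} (\<lambda>_. cube_law d p) \<Otimes>\<^sub>M Rd d)"
    and "(\<integral>\<^sup>+x. ennreal (g (fst x) (J (snd x))) \<partial>tracing_law d n A (cube_law d p))
      = ennreal (\<Sum>T\<in>{0..n} \<rightarrow>\<^sub>E cube d. sample_weight d p {0..n} T *
          (\<Sum>X\<in>V. statistic_law d A J (restrict T {1..n}) X * g T X))"
proof -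
  let ?P = "PiM {0..n} (\<lambda>_. cube_law d p)"
  have sP: "sets ?P = sets (count_space ({0..n} \<rightarrow>\<^sub>E cube d))"
    using sets_PiM_cube_law [OF p, of "{0..n}"] by simp
  have gX: "(\<lambda>T. g T X) \<in> borel_measurable ?P" for X
    unfolding measurable_cong_sets [OF sP refl] by simp
  show meas: "(\<lambda>x. g (fst x) (J (snd x))) \<in> borel_measurable (?P \<Otimes>\<^sub>M Rd d)"
  proof (rule measurable_compose_countable' [where f = "\<lambda>X x. g (fst x) X" and I = V])
    show "(\<lambda>x. g (fst x) X) \<in> borel_measurable (?P \<Otimes>\<^sub>M Rd d)" for X
      by (rule measurable_compose [OF measurable_fst gX])
    show "(\<lambda>x. J (snd x)) \<in> ?P \<Otimes>\<^sub>M Rd d \<rightarrow>\<^sub>M count_space V"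
      by (rule measurable_compose [OF measurable_snd J])
  qed (rule countable_finite [OF V])
  have "(\<integral>\<^sup>+x. ennreal (g (fst x) (J (snd x))) \<partial>tracing_law d n A (cube_law d p))
      = (\<Sum>T\<in>{0..n} \<rightarrow>\<^sub>E cube d. ennreal (sample_weight d p {0..n} T) *
          (\<integral>\<^sup>+\<mu>. ennreal (g T (J \<mu>)) \<partial>A (restrict T {1..n})))"
    by (subst nn_integral_tracing_law [OF p A]) (simp_all add: measurable_compose [OF meas measurable_ennreal])
  also have "\<dots> = (\<Sum>T\<in>{0..n} \<rightarrow>\<^sub>E cube d. ennreal (sample_weight d p {0..n} T *
      (\<Sum>X\<in>V. statistic_law d A J (restrict T {1..n}) X * g T X)))"
  proof (rule sum.cong [OF refl])
    fix T assume T: "T \<in> {0..n} \<rightarrow>\<^sub>E cube d"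
    then have T': "restrict T {1..n} \<in> {1..n} \<rightarrow>\<^sub>E cube d"
      by (auto simp: PiE_iff)
    have "0 \<le> sample_weight d p {0..n} T"
      using T p by (intro sample_weight_nonneg)
    moreover have "0 \<le> (\<Sum>X\<in>V. statistic_law d A J (restrict T {1..n}) X * g T X)"
      using g by (intro sum_nonneg mult_nonneg_nonneg statistic_law_bounds [OF A T']) auto
    ultimately show "ennreal (sample_weight d p {0..n} T) *
        (\<integral>\<^sup>+\<mu>. ennreal (g T (J \<mu>)) \<partial>A (restrict T {1..n}))
        = ennreal (sample_weight d p {0..n} T *
          (\<Sum>X\<in>V. statistic_law d A J (restrict T {1..n}) X * g T X))"
      using g by (subst nn_integral_statistic [OF A T' J V]) (auto simp: ennreal_mult)
  qed
  also have "\<dots> = ennreal (\<Sum>T\<in>{0..n} \<rightarrow>\<^sub>E cube d. sample_weight d p {0..n} T *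
      (\<Sum>X\<in>V. statistic_law d A J (restrict T {1..n}) X * g T X))"
  proof (rule sum_ennreal)
    fix T assume T: "T \<in> {0..n} \<rightarrow>\<^sub>E cube d"
    then have T': "restrict T {1..n} \<in> {1..n} \<rightarrow>\<^sub>E cube d"
      by (auto simp: PiE_iff)
    show "0 \<le> sample_weight d p {0..n} T *
        (\<Sum>X\<in>V. statistic_law d A J (restrict T {1..n}) X * g T X)"
      using T p g by (intro mult_nonneg_nonneg sum_nonneg sample_weight_nonneg
          statistic_law_bounds [OF A T']) auto
  qed
  finally show "(\<integral>\<^sup>+x. ennreal (g (fst x) (J (snd x))) \<partial>tracing_law d n A (cube_law d p))
      = ennreal (\<Sum>T\<in>{0..n} \<rightarrow>\<^sub>E cube d. sample_weight d p {0..n} T *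
          (\<Sum>X\<in>V. statistic_law d A J (restrict T {1..n}) X * g T X))" .
qed

section \<open>Separating the fresh point from the sample\<close>

lemma sum_sample_weight_insert:
  assumes "finite I" "i \<notin> I"
  shows "(\<Sum>T\<in>insert i I \<rightarrow>\<^sub>E cube d. sample_weight d p (insert i I) T * h (T i) (restrict T I))
    = (\<Sum>z\<in>cube d. \<Sum>S\<in>I \<rightarrow>\<^sub>E cube d. cube_weight d p z * sample_weight d p I S * h z S)"
proof -
  let ?F = "\<lambda>(z, S). S(i := z)"
  have inj: "inj_on ?F (cube d \<times> (I \<rightarrow>\<^sub>E cube d))"
    using assms by (intro inj_combinator)
  have "(\<Sum>T\<in>insert i I \<rightarrow>\<^sub>E cube d. sample_weight d p (insert i I) T * h (T i) (restrict T I))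
      = (\<Sum>x\<in>cube d \<times> (I \<rightarrow>\<^sub>E cube d). sample_weight d p (insert i I) (?F x)
          * h (?F x i) (restrict (?F x) I))"
    unfolding PiE_insert_eq by (subst sum.reindex [OF inj]) simp
  also have "\<dots> = (\<Sum>(z, S)\<in>cube d \<times> (I \<rightarrow>\<^sub>E cube d). cube_weight d p z * sample_weight d p I S * h z S)"
  proof (rule sum.cong [OF refl], clarify)
    fix z S assume S: "S \<in> I \<rightarrow>\<^sub>E cube d"
    have "sample_weight d p I (S(i := z)) = sample_weight d p I S"
      using assms by (auto simp: sample_weight_def intro!: prod.cong)
    moreover have "restrict (S(i := z)) I = S"
      using S assms by (auto simp: fun_eq_iff restrict_def PiE_iff extensional_def)
    ultimately show "sample_weight d p (insert i I) (S(i := z)) * h ((S(i := z)) i) (restrict (S(i := z)) I)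
        = cube_weight d p z * sample_weight d p I S * h z S"
      using assms by (simp add: sample_weight_def)
  qed
  finally show ?thesis
    by (simp add: sum.cartesian_product)
qed

text \<open>As the selection ignores the point with index \<open>i\<close>, that point can be
  averaged first, with \<open>X\<close> held fixed. So a tail bound for fixed sets applies to the
  selected set.\<close>

lemma sum_sample_weight_insert_fresh:
  assumes "finite I" "i \<notin> I"
  shows "(\<Sum>T\<in>insert i I \<rightarrow>\<^sub>E cube d. sample_weight d p (insert i I) T *
      (\<Sum>X\<in>V. r (restrict T I) X * f X (T i)))
    = (\<Sum>S\<in>I \<rightarrow>\<^sub>E cube d. sample_weight d p I S *
      (\<Sum>X\<in>V. r S X * (\<Sum>z\<in>cube d. cube_weight d p z * f X z)))"
proof -
  have "(\<Sum>T\<in>insert i I \<rightarrow>\<^sub>E cube d. sample_weight d p (insert i I) T *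
      (\<Sum>X\<in>V. r (restrict T I) X * f X (T i)))
    = (\<Sum>z\<in>cube d. \<Sum>S\<in>I \<rightarrow>\<^sub>E cube d.
        cube_weight d p z * sample_weight d p I S * (\<Sum>X\<in>V. r S X * f X z))"
    using assms by (rule sum_sample_weight_insert [where h = "\<lambda>z S. \<Sum>X\<in>V. r S X * f X z"])
  also have "\<dots> = (\<Sum>S\<in>I \<rightarrow>\<^sub>E cube d. \<Sum>z\<in>cube d.
        cube_weight d p z * sample_weight d p I S * (\<Sum>X\<in>V. r S X * f X z))"
    by (rule sum.swap)
  also have "\<dots> = (\<Sum>S\<in>I \<rightarrow>\<^sub>E cube d. sample_weight d p I S *
      (\<Sum>X\<in>V. r S X * (\<Sum>z\<in>cube d. cube_weight d p z * f X z)))"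
  proof (rule sum.cong [OF refl])
    fix S
    have "(\<Sum>z\<in>cube d. cube_weight d p z * sample_weight d p I S * (\<Sum>X\<in>V. r S X * f X z))
        = (\<Sum>z\<in>cube d. \<Sum>X\<in>V. sample_weight d p I S * (r S X * (cube_weight d p z * f X z)))"
      unfolding sum_distrib_left by (intro sum.cong refl) (simp only: mult_ac)
    also have "\<dots> = (\<Sum>X\<in>V. \<Sum>z\<in>cube d. sample_weight d p I S * (r S X * (cube_weight d p z * f X z)))"
      by (rule sum.swap)
    also have "\<dots> = sample_weight d p I S * (\<Sum>X\<in>V. r S X * (\<Sum>z\<in>cube d. cube_weight d p z * f X z))"
      by (simp only: sum_distrib_left)
    finally show "(\<Sum>z\<in>cube d. cube_weight d p z * sample_weight d p I S * (\<Sum>X\<in>V. r S X * f X z))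
        = sample_weight d p I S * (\<Sum>X\<in>V. r S X * (\<Sum>z\<in>cube d. cube_weight d p z * f X z))" .
  qed
  finally show ?thesis .
qed

lemma sum_sample_weight_insert_restrict:
  assumes "finite I" "i \<notin> I"
  shows "(\<Sum>T\<in>insert i I \<rightarrow>\<^sub>E cube d. sample_weight d p (insert i I) T * h (restrict T I))
    = (\<Sum>S\<in>I \<rightarrow>\<^sub>E cube d. sample_weight d p I S * h S)"
proof -
  have "(\<Sum>T\<in>insert i I \<rightarrow>\<^sub>E cube d. sample_weight d p (insert i I) T * h (restrict T I))
      = (\<Sum>z\<in>cube d. \<Sum>S\<in>I \<rightarrow>\<^sub>E cube d. cube_weight d p z * sample_weight d p I S * h S)"
    using assms by (rule sum_sample_weight_insert [where h = "\<lambda>z S. h S"])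
  also have "\<dots> = (\<Sum>z\<in>cube d. cube_weight d p z * (\<Sum>S\<in>I \<rightarrow>\<^sub>E cube d. sample_weight d p I S * h S))"
    by (simp only: sum_distrib_left mult.assoc)
  also have "\<dots> = (\<Sum>S\<in>I \<rightarrow>\<^sub>E cube d. sample_weight d p I S * h S)"
    by (simp only: sum_distrib_right [symmetric] sum_cube_weight mult_1)
  finally show ?thesis .
qed

text \<open>The tracing function scores a point on the coordinates selected by the estimate. The
  threshold l satisfies l^2 / (2 s) = ln (1/\<xi>), which makes the Chernoff bound for a fresh point
  exactly \<xi>.\<close>

lemma traceable_by_score:
  assumes p: "\<forall>j<d. \<bar>p j\<bar> \<le> 1" and A: "estimator (sign_cube d) d n A"
    and J: "J \<in> Rd d \<rightarrow>\<^sub>M count_space V"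
    and V: "finite V" "\<And>X. X \<in> V \<Longrightarrow> X \<subseteq> {..<d} \<and> card X = s" and s: "s > 0"
    and \<xi>: "0 < \<xi>" "\<xi> < 1"
    and m: "m \<le> (\<Sum>S\<in>{1..n} \<rightarrow>\<^sub>E cube d. sample_weight d p {1..n} S *
      (\<Sum>X\<in>V. statistic_law d A J S X *
        card {i \<in> {1..n}. sqrt (2 * real s * ln (1 / \<xi>)) \<le> score X p (S i)}))"
  shows "traceable (sign_cube d) d n A \<xi> m"
proof -
  define l where "l = sqrt (2 * real s * ln (1 / \<xi>))"
  define L where "L = tracing_law d n A (cube_law d p)"
  let ?P = "PiM {0..n} (\<lambda>_. cube_law d p)"
  let ?\<phi> = "\<lambda>x. score (J (fst x)) p (snd x)"
  have ins: "{0..n} = insert 0 {1..n}"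
    by auto
  have D: "cube_law d p \<in> space (prob_algebra (sign_cube d))"
    using p by (rule cube_law_in_prob_algebra)
  have "L \<in> space (prob_algebra (?P \<Otimes>\<^sub>M Rd d))"
    unfolding L_def by (rule tracing_law_in_prob_algebra [OF A D])
  then have sL: "sets L = sets (?P \<Otimes>\<^sub>M Rd d)" and pL: "prob_space L"
    by (auto simp: space_prob_algebra)
  interpret prob_space L by (rule pL)
  have "?\<phi> \<in> borel_measurable (Rd d \<Otimes>\<^sub>M sign_cube d)"
  proof (rule measurable_compose_countable' [where f = "\<lambda>X x. score X p (snd x)" and I = V])
    show "(\<lambda>x. score X p (snd x)) \<in> borel_measurable (Rd d \<Otimes>\<^sub>M sign_cube d)" for X
    proof (rule measurable_compose [OF measurable_snd])
      show "score X p \<in> borel_measurable (sign_cube d)"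
        by (simp add: sign_cube_def)
    qed
    show "(\<lambda>x. J (fst x)) \<in> Rd d \<Otimes>\<^sub>M sign_cube d \<rightarrow>\<^sub>M count_space V"
      by (rule measurable_compose [OF measurable_fst J])
  qed (rule countable_finite [OF V(1)])
  moreover have "measure L {(S, \<mu>) \<in> space L. ?\<phi> (\<mu>, S 0) \<ge> l} \<le> \<xi>"
  proof -
    define g where "g T X = (if l \<le> score X p (T 0) then 1 else 0 :: real)" for T :: "nat \<Rightarrow> nat \<Rightarrow> real" and X
    note G = nn_integral_tracing_law_statistic [OF p A J V(1), where g = g]
    have "(\<Sum>T\<in>{0..n} \<rightarrow>\<^sub>E cube d. sample_weight d p {0..n} T *
          (\<Sum>X\<in>V. statistic_law d A J (restrict T {1..n}) X * g T X))
        = (\<Sum>S\<in>{1..n} \<rightarrow>\<^sub>E cube d. sample_weight d p {1..n} S * (\<Sum>X\<in>V. statistic_law d A J S X *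
        (\<Sum>z\<in>cube d. cube_weight d p z * (if l \<le> score X p z then 1 else 0))))"
      unfolding ins g_def by (rule sum_sample_weight_insert_fresh) auto
    also have "\<dots> \<le> (\<Sum>S\<in>{1..n} \<rightarrow>\<^sub>E cube d. sample_weight d p {1..n} S * (\<Sum>X\<in>V. statistic_law d A J S X * \<xi>))"
    proof (intro sum_mono mult_left_mono sample_weight_nonneg statistic_law_bounds [OF A] p)
      fix X assume "X \<in> V"
      then have X: "X \<subseteq> {..<d}" "card X = s"
        using V by auto
      have "(\<Sum>z\<in>cube d. cube_weight d p z * (if l \<le> score X p z then 1 else 0))
          \<le> exp (- (l\<^sup>2 / (2 * card X)))"
        using p X s \<xi> by (intro score_tail) (auto simp: l_def)
      also have "l\<^sup>2 / (2 * card X) = ln (1 / \<xi>)"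
        using X s \<xi> by (simp add: l_def)
      also have "exp (- ln (1 / \<xi>)) = \<xi>"
        using \<xi> by (simp add: ln_div)
      finally show "(\<Sum>z\<in>cube d. cube_weight d p z * (if l \<le> score X p z then 1 else 0)) \<le> \<xi>" .
    qed auto
    also have "\<dots> = (\<Sum>S\<in>{1..n} \<rightarrow>\<^sub>E cube d. sample_weight d p {1..n} S * \<xi>)"
      by (intro sum.cong refl)
        (simp only: sum_distrib_right [symmetric] sum_statistic_law [OF A _ J V(1)] mult_1)
    also have "\<dots> = \<xi>"
      unfolding sum_distrib_right [symmetric] by (simp only: sum_sample_weight finite_atLeastAtMost mult_1)
    finally have le: "(\<Sum>T\<in>{0..n} \<rightarrow>\<^sub>E cube d. sample_weight d p {0..n} T *
          (\<Sum>X\<in>V. statistic_law d A J (restrict T {1..n}) X * g T X)) \<le> \<xi>" .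
    have "(\<lambda>x. g (fst x) (J (snd x))) \<in> borel_measurable L"
      unfolding measurable_cong_sets [OF sL refl] by (rule G) (auto simp: g_def)
    then have "{x \<in> space L. g (fst x) (J (snd x)) \<ge> 1} \<in> sets L"
      by (intro borel_measurable_le borel_measurable_const)
    moreover have "{x \<in> space L. g (fst x) (J (snd x)) \<ge> 1} = {(S, \<mu>) \<in> space L. ?\<phi> (\<mu>, S 0) \<ge> l}"
      by (auto simp: g_def split: if_splits)
    ultimately have "emeasure L {(S, \<mu>) \<in> space L. ?\<phi> (\<mu>, S 0) \<ge> l}
        = (\<integral>\<^sup>+x. indicator {(S, \<mu>) \<in> space L. ?\<phi> (\<mu>, S 0) \<ge> l} x \<partial>L)"
      by simp
    also have "\<dots> = (\<integral>\<^sup>+x. ennreal (g (fst x) (J (snd x))) \<partial>L)"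
      by (intro nn_integral_cong) (auto simp: g_def indicator_def)
    also have "\<dots> = ennreal (\<Sum>T\<in>{0..n} \<rightarrow>\<^sub>E cube d. sample_weight d p {0..n} T *
          (\<Sum>X\<in>V. statistic_law d A J (restrict T {1..n}) X * g T X))"
      unfolding L_def by (rule G) (auto simp: g_def)
    also have "\<dots> \<le> ennreal \<xi>"
      by (rule ennreal_leI [OF le])
    finally show ?thesis
      unfolding measure_def using \<xi> by (intro enn2real_leI) auto
  qed
  moreover have "m \<le> (\<integral>(S, \<mu>). real (card {i \<in> {1..n}. ?\<phi> (\<mu>, S i) \<ge> l}) \<partial>L)"
  proof -
    define g where "g T X = real (card {i \<in> {1..n}. l \<le> score X p (T i)})" for T :: "nat \<Rightarrow> nat \<Rightarrow> real" and X
    note G = nn_integral_tracing_law_statistic [OF p A J V(1), where g = g]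
    have meas: "(\<lambda>x. g (fst x) (J (snd x))) \<in> borel_measurable L"
      unfolding measurable_cong_sets [OF sL refl] by (rule G) (auto simp: g_def)
    \<comment> \<open>Only the indices 1 to \<open>n\<close> are counted, so the count is a function
      of the restricted sample and the weight of \<open>T 0\<close> sums out to 1.\<close>
    have g_restrict: "g (restrict T {1..n}) X = g T X" for T X
      unfolding g_def by (intro arg_cong [where f = "\<lambda>A. real (card A)"] Collect_cong) auto
    have "(\<Sum>T\<in>{0..n} \<rightarrow>\<^sub>E cube d. sample_weight d p {0..n} T *
          (\<Sum>X\<in>V. statistic_law d A J (restrict T {1..n}) X * g T X))
        = (\<Sum>T\<in>{0..n} \<rightarrow>\<^sub>E cube d. sample_weight d p {0..n} T *
          (\<Sum>X\<in>V. statistic_law d A J (restrict T {1..n}) X * g (restrict T {1..n}) X))"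
      by (simp only: g_restrict)
    also have "\<dots> = (\<Sum>S\<in>{1..n} \<rightarrow>\<^sub>E cube d. sample_weight d p {1..n} S *
          (\<Sum>X\<in>V. statistic_law d A J S X * g S X))"
      unfolding ins
      by (rule sum_sample_weight_insert_restrict [where h = "\<lambda>S. \<Sum>X\<in>V. statistic_law d A J S X * g S X"]) auto
    finally have eq: "(\<Sum>T\<in>{0..n} \<rightarrow>\<^sub>E cube d. sample_weight d p {0..n} T *
          (\<Sum>X\<in>V. statistic_law d A J (restrict T {1..n}) X * g T X))
        = (\<Sum>S\<in>{1..n} \<rightarrow>\<^sub>E cube d. sample_weight d p {1..n} S *
          (\<Sum>X\<in>V. statistic_law d A J S X * g S X))" .
    have "0 \<le> (\<Sum>S\<in>{1..n} \<rightarrow>\<^sub>E cube d. sample_weight d p {1..n} S *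
          (\<Sum>X\<in>V. statistic_law d A J S X * g S X))"
      by (intro sum_nonneg mult_nonneg_nonneg sample_weight_nonneg statistic_law_bounds [OF A] p)
        (auto simp: g_def)
    moreover have "(\<integral>\<^sup>+x. ennreal (g (fst x) (J (snd x))) \<partial>L) = ennreal (\<Sum>S\<in>{1..n} \<rightarrow>\<^sub>E cube d.
        sample_weight d p {1..n} S * (\<Sum>X\<in>V. statistic_law d A J S X * g S X))"
      unfolding L_def eq [symmetric] by (rule G) (auto simp: g_def)
    ultimately have int: "(\<integral>x. g (fst x) (J (snd x)) \<partial>L) = (\<Sum>S\<in>{1..n} \<rightarrow>\<^sub>E cube d.
        sample_weight d p {1..n} S * (\<Sum>X\<in>V. statistic_law d A J S X * g S X))"
      using integral_eq_nn_integral [OF meas] by (simp add: g_def)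
    have "(\<lambda>(S, \<mu>). real (card {i \<in> {1..n}. ?\<phi> (\<mu>, S i) \<ge> l})) = (\<lambda>x. g (fst x) (J (snd x)))"
      by (simp add: g_def case_prod_beta')
    then show ?thesis
      using m by (simp only: int) (simp only: g_def l_def)
  qed
  ultimately show ?thesis
    unfolding traceable_def
    by (intro conjI \<xi> bexI [of _ ?\<phi>] bexI [OF _ D] exI [of _ l]) (simp_all add: L_def)
qed

section \<open>Selecting one coordinate per block\<close>

definition block :: "nat \<Rightarrow> nat \<Rightarrow> nat set" where
  "block b t = {t * b..<Suc t * b}"

text \<open>Ties are broken by the least index, which makes the choice a measurable function of the
  estimate.\<close>

definition argmax_on :: "nat set \<Rightarrow> (nat \<Rightarrow> real) \<Rightarrow> nat" where
  "argmax_on B \<mu> = (LEAST j. j \<in> B \<and> (\<forall>i\<in>B. \<mu> i \<le> \<mu> j))"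

definition block_argmax :: "nat \<Rightarrow> nat \<Rightarrow> (nat \<Rightarrow> real) \<Rightarrow> nat set" where
  "block_argmax s b \<mu> = (\<lambda>t. argmax_on (block b t) \<mu>) ` {..<s}"

text \<open>A finite family that contains all values of \<open>block_argmax\<close> and over which
  the union bound runs; its size is at most b^s.\<close>

definition transversals :: "nat \<Rightarrow> nat \<Rightarrow> nat set set" where
  "transversals s b = (\<lambda>v. v ` {..<s}) ` (\<Pi>\<^sub>E t\<in>{..<s}. block b t)"

lemma finite_block [simp]: "finite (block b t)"
  by (simp add: block_def)

lemma card_block [simp]: "card (block b t) = b"
  by (simp add: block_def)

lemma block_nonempty: "b > 0 \<Longrightarrow> block b t \<noteq> {}"
  by (simp add: block_def)

lemma block_subset:
  assumes "t < s" "s * b \<le> d"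
  shows "block b t \<subseteq> {..<d}"
proof -
  have "Suc t * b \<le> s * b"
    using assms by (intro mult_le_mono1) simp
  with assms show ?thesis
    by (auto simp: block_def)
qed

text \<open>Recovering the block index from a coordinate makes any choice of one coordinate per
  block injective, so selected sets have exactly \<open>s\<close> elements.\<close>

lemma div_block:
  assumes "j \<in> block b t"
  shows "j div b = t"
  using assms by (intro div_nat_eqI) (auto simp: block_def mult.commute)

lemma argmax_on:
  assumes "finite B" "B \<noteq> {}"
  shows "argmax_on B \<mu> \<in> B" "i \<in> B \<Longrightarrow> \<mu> i \<le> \<mu> (argmax_on B \<mu>)"
proof -
  have "Max (\<mu> ` B) \<in> \<mu> ` B"
    using assms by (intro Max_in) auto
  then obtain j where j: "j \<in> B" "Max (\<mu> ` B) = \<mu> j"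
    by auto
  have "\<mu> i \<le> \<mu> j" if "i \<in> B" for i
    using assms that by (simp add: j(2) [symmetric])
  then have "\<exists>j. j \<in> B \<and> (\<forall>i\<in>B. \<mu> i \<le> \<mu> j)"
    using j by blast
  from LeastI_ex [OF this] show "argmax_on B \<mu> \<in> B" "i \<in> B \<Longrightarrow> \<mu> i \<le> \<mu> (argmax_on B \<mu>)"
    unfolding argmax_on_def by blast+
qed

lemma measurable_Rd_component:
  assumes "j < d"
  shows "(\<lambda>\<mu>. \<mu> j) \<in> borel_measurable (Rd d)"
  unfolding Rd_def using assms by (intro measurable_component_singleton) auto

lemma measurable_argmax_on:
  assumes "B \<subseteq> {..<d}"
  shows "argmax_on B \<in> Rd d \<rightarrow>\<^sub>M count_space UNIV"
  unfolding argmax_on_def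
proof (rule measurable_Least)
  fix j
  show "Measurable.pred (Rd d) (\<lambda>\<mu>. j \<in> B \<and> (\<forall>i\<in>B. \<mu> i \<le> \<mu> j))"
  proof (cases "j \<in> B")
    case True
    have "Measurable.pred (Rd d) (\<lambda>\<mu>. \<forall>i\<in>B. \<mu> i \<le> \<mu> j)"
    proof (rule pred_intros_finite)
      show "finite B"
        using assms finite_subset by blast
      fix i assume "i \<in> B"
      with True assms show "Measurable.pred (Rd d) (\<lambda>\<mu>. \<mu> i \<le> \<mu> j)"
        unfolding pred_def by (intro borel_measurable_le measurable_Rd_component) auto
    qed
    with True show ?thesis
      by simp
  qed simp
qed

lemma transversalsD:
  assumes "X \<in> transversals s b" "b > 0" "s * b \<le> d"
  shows "X \<subseteq> {..<d}" "card X = s"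
    and "(\<Sum>j\<in>X. p j) \<le> (\<Sum>t<s. Max (p ` block b t) :: real)"
proof -
  obtain v where v: "\<And>t. t < s \<Longrightarrow> v t \<in> block b t" "X = v ` {..<s}"
    using assms by (auto simp: transversals_def PiE_iff)
  show "X \<subseteq> {..<d}"
    using v block_subset assms by fastforce
  have inj: "inj_on v {..<s}"
    using v(1) div_block by (intro inj_on_inverseI [of _ "\<lambda>j. j div b"]) auto
  then show "card X = s"
    using v by (simp add: card_image)
  have "(\<Sum>j\<in>X. p j) = (\<Sum>t<s. p (v t))"
    using inj by (simp add: v(2) sum.reindex)
  also have "\<dots> \<le> (\<Sum>t<s. Max (p ` block b t))"
    using v(1) by (intro sum_mono Max_ge) auto
  finally show "(\<Sum>j\<in>X. p j) \<le> (\<Sum>t<s. Max (p ` block b t))" .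
qed

lemma finite_transversals: "finite (transversals s b)"
  unfolding transversals_def by (intro finite_imageI finite_PiE) auto

lemma card_transversals_le: "card (transversals s b) \<le> b ^ s"
proof -
  have "card (transversals s b) \<le> card (\<Pi>\<^sub>E t\<in>{..<s}. block b t)"
    unfolding transversals_def by (intro card_image_le finite_PiE) auto
  then show ?thesis
    by (simp add: card_PiE)
qed

lemma block_argmax_in_transversals:
  assumes "b > 0"
  shows "block_argmax s b \<mu> \<in> transversals s b"
  unfolding transversals_def
proof (rule image_eqI)
  show "block_argmax s b \<mu> = restrict (\<lambda>t. argmax_on (block b t) \<mu>) {..<s} ` {..<s}"
    by (simp add: block_argmax_def)
  show "restrict (\<lambda>t. argmax_on (block b t) \<mu>) {..<s} \<in> (\<Pi>\<^sub>E t\<in>{..<s}. block b t)"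
    using argmax_on(1) [OF finite_block block_nonempty [OF assms]] by auto
qed

lemma measurable_block_argmax:
  assumes "b > 0" "s * b \<le> d"
  shows "block_argmax s b \<in> Rd d \<rightarrow>\<^sub>M count_space (transversals s b)"
  unfolding measurable_count_space_eq2 [OF finite_transversals]
proof (intro conjI ballI)
  show "block_argmax s b \<in> space (Rd d) \<rightarrow> transversals s b"
    using block_argmax_in_transversals [OF assms(1)] by auto
  fix X assume X: "X \<in> transversals s b"
  then have "finite X"
    using transversalsD(1) [OF X assms] finite_subset by blast
  have m: "argmax_on (block b t) \<in> Rd d \<rightarrow>\<^sub>M count_space UNIV" if "t < s" for t
    using block_subset [OF that assms(2)] by (rule measurable_argmax_on)
  have in_pred: "Measurable.pred (Rd d) (\<lambda>\<mu>. argmax_on (block b t) \<mu> \<in> Y)" if "t < s" for t Y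
    using measurable_sets [OF m [OF that], of Y] by (simp add: pred_def vimage_def Int_def conj_commute)
  \<comment> \<open>Equality of the selected set with \<open>X\<close> is written as two inclusions,
    each a finite combination of events about a single argmax.\<close>
  have "Measurable.pred (Rd d) (\<lambda>\<mu>. (\<forall>t\<in>{..<s}. argmax_on (block b t) \<mu> \<in> X) \<and>
      (\<forall>j\<in>X. \<exists>t\<in>{..<s}. argmax_on (block b t) \<mu> \<in> {j}))"
    by (intro pred_intros_logic pred_intros_finite in_pred \<open>finite X\<close> finite_lessThan; simp)
  also have "(\<lambda>\<mu>. (\<forall>t\<in>{..<s}. argmax_on (block b t) \<mu> \<in> X) \<and>
      (\<forall>j\<in>X. \<exists>t\<in>{..<s}. argmax_on (block b t) \<mu> \<in> {j})) = (\<lambda>\<mu>. block_argmax s b \<mu> = X)"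
    by (auto simp: fun_eq_iff block_argmax_def)
  finally show "block_argmax s b -` {X} \<inter> space (Rd d) \<in> sets (Rd d)"
    by (simp add: pred_def vimage_def Int_def conj_commute)
qed

section \<open>The sup norm and the loss of the selection\<close>

lemma abs_le_linf_norm: "j < d \<Longrightarrow> \<bar>x j\<bar> \<le> linf_norm d x"
  unfolding linf_norm_def by (intro Max_ge) auto

lemma linf_norm_nonneg: "0 \<le> linf_norm d x"
  unfolding linf_norm_def by (intro Max_ge) auto

lemma linf_norm_cong: "(\<And>j. j < d \<Longrightarrow> x j = y j) \<Longrightarrow> linf_norm d x = linf_norm d y"
  unfolding linf_norm_def by (intro arg_cong [where f = Max] arg_cong [where f = "insert 0"] image_cong) auto

lemma measurable_linf_norm: "(\<lambda>\<mu>. linf_norm d (\<lambda>j. \<mu> j - p j)) \<in> borel_measurable (Rd d)"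
proof -
  \<comment> \<open>The extra index \<open>d\<close> carries the inserted 0, so that the maximum
    runs over a fixed nonempty index set.\<close>
  have "insert 0 ((\<lambda>j. \<bar>\<mu> j - p j\<bar>) ` {..<d}) = (\<lambda>j. if j < d then \<bar>\<mu> j - p j\<bar> else 0) ` {..d}"
    for \<mu> :: "nat \<Rightarrow> real"
    by (force simp: image_iff le_less)
  moreover have "(\<lambda>\<mu>. if j < d then \<bar>\<mu> j - p j\<bar> else 0) \<in> borel_measurable (Rd d)" for j
    using measurable_Rd_component [of j d]
    by (cases "j < d") (auto intro!: borel_measurable_abs borel_measurable_diff)
  ultimately show ?thesis
    unfolding linf_norm_def by (simp only:) (intro borel_measurable_Max; simp)
qed

text \<open>In each block the estimate ranks its own choice at least as high as the true maximiser,
  and it errs by at most the norm on either of the two coordinates.\<close>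

lemma sum_Max_block_le:
  assumes "b > 0" "s * b \<le> d"
  shows "(\<Sum>t<s. Max (p ` block b t)) - (\<Sum>j\<in>block_argmax s b \<mu>. p j)
    \<le> 2 * real s * linf_norm d (\<lambda>j. \<mu> j - p j)"
proof -
  let ?N = "linf_norm d (\<lambda>j. \<mu> j - p j)"
  let ?a = "\<lambda>t. argmax_on (block b t) \<mu>"
  note a = argmax_on [OF finite_block block_nonempty [OF assms(1)]]
  have "inj_on ?a {..<s}"
    using div_block [OF a(1)] by (intro inj_on_inverseI [of _ "\<lambda>j. j div b"]) auto
  then have "(\<Sum>t<s. Max (p ` block b t)) - (\<Sum>j\<in>block_argmax s b \<mu>. p j)
      = (\<Sum>t<s. Max (p ` block b t) - p (?a t))"
    by (simp add: block_argmax_def sum.reindex sum_subtractf)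
  also have "\<dots> \<le> (\<Sum>t<s. 2 * ?N)"
  proof (rule sum_mono)
    fix t assume "t \<in> {..<s}"
    then have sub: "block b t \<subseteq> {..<d}"
      using block_subset assms by auto
    have "Max (p ` block b t) \<in> p ` block b t"
      using block_nonempty [OF assms(1)] by (intro Max_in) auto
    then obtain i where i: "i \<in> block b t" "Max (p ` block b t) = p i"
      by auto
    have "\<bar>\<mu> i - p i\<bar> \<le> ?N" "\<bar>\<mu> (?a t) - p (?a t)\<bar> \<le> ?N"
      using abs_le_linf_norm [of i d "\<lambda>j. \<mu> j - p j"] abs_le_linf_norm [of "?a t" d "\<lambda>j. \<mu> j - p j"]
        i(1) a(1) [of t] sub by auto
    with a(2) [OF i(1), of \<mu>] i(2) show "Max (p ` block b t) - p (?a t) \<le> 2 * ?N"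
      by linarith
  qed
  finally show ?thesis
    by simp
qed

text \<open>Expectation of the selection loss: 2 s times the error \<alpha>/2. The loss is
  nonnegative, since no transversal beats the block maxima, so the estimate can be carried out in
  \<open>ennreal\<close>, where the accuracy hypothesis is stated, and no integrability of the norm
  has to be shown.\<close>

lemma accurate_selection_mean_ge:
  assumes p: "\<forall>j<d. \<bar>p j\<bar> \<le> 1" and A: "estimator (sign_cube d) d n A"
    and acc: "(\<integral>\<^sup>+\<mu>. ennreal (linf_norm d (\<lambda>j. \<mu> j - (\<integral>z. z j \<partial>cube_law d p)))
      \<partial>estimate_law n A (cube_law d p)) \<le> ennreal (\<alpha> / 2)"
    and \<alpha>: "\<alpha> > 0" and bs: "b > 0" "s * b \<le> d"
  shows "(\<Sum>t<s. Max (p ` block b t)) - s * \<alpha>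
    \<le> (\<Sum>S\<in>{1..n} \<rightarrow>\<^sub>E cube d. sample_weight d p {1..n} S *
        (\<Sum>X\<in>transversals s b. statistic_law d A (block_argmax s b) S X * (\<Sum>j\<in>X. p j)))"
proof -
  define C where "C = (\<Sum>t<s. Max (p ` block b t))"
  define N where "N \<mu> = linf_norm d (\<lambda>j. \<mu> j - p j)" for \<mu>
  define r where "r = statistic_law d A (block_argmax s b)"
  let ?\<Omega> = "{1..n} \<rightarrow>\<^sub>E cube d" and ?V = "transversals s b"
  let ?w = "sample_weight d p {1..n}"
  note J = measurable_block_argmax [OF bs]
  have w: "0 \<le> ?w S" if "S \<in> ?\<Omega>" for S
    using p that by (rule sample_weight_nonneg)
  have C: "0 \<le> C - (\<Sum>j\<in>X. p j)" if "X \<in> ?V" for X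
    using transversalsD(3) [OF that bs, of p] by (simp add: C_def)
  have r: "0 \<le> r S X" if "S \<in> ?\<Omega>" for S X
    unfolding r_def by (rule statistic_law_bounds [OF A that])
  have N: "(\<lambda>\<mu>. ennreal (N \<mu>)) \<in> borel_measurable (Rd d)"
    unfolding N_def by (rule measurable_compose [OF measurable_linf_norm measurable_ennreal])
  have "linf_norm d (\<lambda>j. \<mu> j - (\<integral>z. z j \<partial>cube_law d p)) = N \<mu>" for \<mu>
    unfolding N_def using integral_cube_law_component [OF p] by (intro linf_norm_cong) auto
  with acc have "(\<integral>\<^sup>+\<mu>. ennreal (N \<mu>) \<partial>estimate_law n A (cube_law d p)) \<le> ennreal (\<alpha> / 2)"
    by simp
  then have accN: "(\<Sum>S\<in>?\<Omega>. ennreal (?w S) * (\<integral>\<^sup>+\<mu>. ennreal (N \<mu>) \<partial>A S)) \<le> ennreal (\<alpha> / 2)"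
    unfolding nn_integral_estimate_law [OF p A N] .
  have "ennreal (\<Sum>S\<in>?\<Omega>. ?w S * (\<Sum>X\<in>?V. r S X * (C - (\<Sum>j\<in>X. p j))))
      = (\<Sum>S\<in>?\<Omega>. ennreal (?w S * (\<Sum>X\<in>?V. r S X * (C - (\<Sum>j\<in>X. p j)))))"
    using w r C by (intro sum_ennreal [symmetric] mult_nonneg_nonneg sum_nonneg) auto
  also have "\<dots> = (\<Sum>S\<in>?\<Omega>. ennreal (?w S) * ennreal (\<Sum>X\<in>?V. r S X * (C - (\<Sum>j\<in>X. p j))))"
    using w r C by (intro sum.cong refl ennreal_mult mult_nonneg_nonneg sum_nonneg) auto
  also have "\<dots> \<le> (\<Sum>S\<in>?\<Omega>. ennreal (?w S) * (ennreal (2 * real s) * (\<integral>\<^sup>+\<mu>. ennreal (N \<mu>) \<partial>A S)))"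
  proof (intro sum_mono mult_left_mono)
    fix S assume S: "S \<in> ?\<Omega>"
    have sS: "sets (A S) = sets (Rd d)"
      by (rule estimator_sign_cubeD [OF A S])
    have "ennreal (\<Sum>X\<in>?V. r S X * (C - (\<Sum>j\<in>X. p j)))
        = (\<integral>\<^sup>+\<mu>. ennreal (C - (\<Sum>j\<in>block_argmax s b \<mu>. p j)) \<partial>A S)"
      unfolding r_def
      by (rule nn_integral_statistic [OF A S J finite_transversals, symmetric]) (rule C)
    also have "\<dots> \<le> (\<integral>\<^sup>+\<mu>. ennreal (2 * real s) * ennreal (N \<mu>) \<partial>A S)"
    proof (rule nn_integral_mono)
      fix \<mu>
      have "ennreal (C - (\<Sum>j\<in>block_argmax s b \<mu>. p j)) \<le> ennreal (2 * real s * N \<mu>)"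
        unfolding C_def N_def by (rule ennreal_leI [OF sum_Max_block_le [OF bs]])
      then show "ennreal (C - (\<Sum>j\<in>block_argmax s b \<mu>. p j)) \<le> ennreal (2 * real s) * ennreal (N \<mu>)"
        by (simp add: ennreal_mult N_def linf_norm_nonneg)
    qed
    also have "\<dots> = ennreal (2 * real s) * (\<integral>\<^sup>+\<mu>. ennreal (N \<mu>) \<partial>A S)"
      by (rule nn_integral_cmult) (use N measurable_cong_sets [OF sS refl] in blast)
    finally show "ennreal (\<Sum>X\<in>?V. r S X * (C - (\<Sum>j\<in>X. p j)))
        \<le> ennreal (2 * real s) * (\<integral>\<^sup>+\<mu>. ennreal (N \<mu>) \<partial>A S)" .
  qed simp
  also have "\<dots> = ennreal (2 * real s) * (\<Sum>S\<in>?\<Omega>. ennreal (?w S) * (\<integral>\<^sup>+\<mu>. ennreal (N \<mu>) \<partial>A S))"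
    unfolding sum_distrib_left by (intro sum.cong refl) (simp only: mult.left_commute)
  also have "\<dots> \<le> ennreal (2 * real s) * ennreal (\<alpha> / 2)"
    by (intro mult_left_mono accN) simp
  also have "\<dots> = ennreal (s * \<alpha>)"
    using \<alpha> by (simp add: ennreal_mult [symmetric])
  finally have "(\<Sum>S\<in>?\<Omega>. ?w S * (\<Sum>X\<in>?V. r S X * (C - (\<Sum>j\<in>X. p j)))) \<le> s * \<alpha>"
    using \<alpha> by (subst (asm) ennreal_le_iff) auto
  moreover have "(\<Sum>S\<in>?\<Omega>. ?w S * (\<Sum>X\<in>?V. r S X * (C - (\<Sum>j\<in>X. p j))))
      = C - (\<Sum>S\<in>?\<Omega>. ?w S * (\<Sum>X\<in>?V. r S X * (\<Sum>j\<in>X. p j)))"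
  proof -
    have "(\<Sum>S\<in>?\<Omega>. ?w S * (\<Sum>X\<in>?V. r S X * (C - (\<Sum>j\<in>X. p j))))
        = (\<Sum>S\<in>?\<Omega>. ?w S * (C - (\<Sum>X\<in>?V. r S X * (\<Sum>j\<in>X. p j))))"
    proof (intro sum.cong refl arg_cong2 [where f = "(*)"])
      fix S assume S: "S \<in> ?\<Omega>"
      have "(\<Sum>X\<in>?V. r S X * (C - (\<Sum>j\<in>X. p j))) = (\<Sum>X\<in>?V. r S X) * C - (\<Sum>X\<in>?V. r S X * (\<Sum>j\<in>X. p j))"
        by (simp only: right_diff_distrib sum_subtractf sum_distrib_right)
      then show "(\<Sum>X\<in>?V. r S X * (C - (\<Sum>j\<in>X. p j))) = C - (\<Sum>X\<in>?V. r S X * (\<Sum>j\<in>X. p j))"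
        unfolding r_def sum_statistic_law [OF A S J finite_transversals] by simp
    qed
    also have "\<dots> = (\<Sum>S\<in>?\<Omega>. ?w S) * C - (\<Sum>S\<in>?\<Omega>. ?w S * (\<Sum>X\<in>?V. r S X * (\<Sum>j\<in>X. p j)))"
      by (simp only: right_diff_distrib sum_subtractf sum_distrib_right)
    also have "(\<Sum>S\<in>?\<Omega>. ?w S) = 1"
      by (rule sum_sample_weight) simp
    finally show ?thesis
      by simp
  qed
  ultimately show ?thesis
    by (simp add: C_def r_def)
qed

text \<open>Some \<open>p\<close> gives a total score of at least 2 (k + 1) \<alpha> s. The
  hypotheses \<open>noise\<close> and \<open>union\<close> each take away at most a quarter of it;
  the remaining half, divided by the cap \<eta> s / 2 per traced point, is the asserted number. The
  hypothesis \<open>Max\<close> says that a block maximum averages at least 2 \<alpha>, using level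
  3 \<alpha> and \<open>t = \<alpha>\<close> in the bound for the absolute moment.\<close>

lemma traceable_of_accurate:
  fixes \<eta> :: real
  assumes A: "estimator (sign_cube d) d n A"
    and acc: "\<And>D. D \<in> space (prob_algebra (sign_cube d)) \<Longrightarrow>
      (\<integral>\<^sup>+\<mu>. ennreal (linf_norm d (\<lambda>j. \<mu> j - (\<integral>z. z j \<partial>D))) \<partial>estimate_law n A D) \<le> ennreal (\<alpha> / 2)"
    and \<alpha>: "\<alpha> > 0" "\<alpha> \<le> 1 / 8" and \<xi>: "0 < \<xi>" "\<xi> < 1" and \<eta>: "\<eta> > 0"
    and bs: "b > 0" "s > 0" "s * b \<le> d" and k: "2 \<le> (2 * real k + 3) * \<alpha>\<^sup>2"
    and Max: "2 * \<alpha> \<le> 3 * \<alpha> * (1 - (1 - (1 - 16 * \<alpha>\<^sup>2) ^ k / 4) ^ b)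
      - (\<alpha> + 1 / (\<alpha> * (2 * real k + 3))) / 2"
    and noise: "n * sqrt (2 * real s * ln (1 / \<xi>)) \<le> (real k + 1) * \<alpha> * s / 2"
    and union: "(s * ln b + n) / \<eta> \<le> (real k + 1) * \<alpha> * s / 2"
  shows "traceable (sign_cube d) d n A \<xi> (2 * (real k + 1) * \<alpha> / \<eta>)"
proof -
  let ?\<Omega> = "{1..n} \<rightarrow>\<^sub>E cube d" and ?V = "transversals s b"
  define r where "r = statistic_law d A (block_argmax s b)"
  define l where "l = sqrt (2 * real s * ln (1 / \<xi>))"
  note J = measurable_block_argmax [OF bs(1,3)]
  note V = transversalsD(1,2) [OF _ bs(1,3)]
  have "2 * \<alpha> \<le> (\<integral>p. Max (p ` block b t) \<partial>prior_PiM d k)" if "t < s" for t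
  proof -
    interpret prob_space "prior k" by (rule prob_space_prior)
    let ?q = "\<integral>x. indicator {3 * \<alpha>..} x \<partial>prior k :: real"
    have "?q \<le> 1"
      by simp
    then have "(1 - ?q) ^ b \<le> (1 - (1 - 16 * \<alpha>\<^sup>2) ^ k / 4) ^ b"
      using prior_tail_ge [of \<alpha> k] \<alpha> k by (intro power_mono) auto
    then have "3 * \<alpha> * (1 - (1 - (1 - 16 * \<alpha>\<^sup>2) ^ k / 4) ^ b) \<le> 3 * \<alpha> * (1 - (1 - ?q) ^ b)"
      using \<alpha> by (intro mult_left_mono) auto
    moreover have "(\<integral>x. \<bar>x\<bar> \<partial>prior k) \<le> (\<alpha> + 1 / (\<alpha> * (2 * real k + 3))) / 2"
      using prior_abs_moment_le [OF \<alpha>(1), of k] .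
    moreover have "3 * \<alpha> * (1 - (1 - ?q) ^ card (block b t)) - (\<integral>x. \<bar>x\<bar> \<partial>prior k)
        \<le> (\<integral>p. Max (p ` block b t) \<partial>prior_PiM d k)"
      using block_subset [OF that bs(3)] block_nonempty [OF bs(1)] \<alpha> by (intro prior_PiM_Max_ge(2)) auto
    ultimately show ?thesis
      using Max unfolding card_block by linarith
  qed
  moreover have "(\<Sum>t<s. Max (p ` block b t)) - s * \<alpha>
      \<le> (\<Sum>S\<in>?\<Omega>. sample_weight d p {1..n} S * (\<Sum>X\<in>?V. r S X * (\<Sum>j\<in>X. p j)))"
    if p: "\<forall>j<d. \<bar>p j\<bar> \<le> 1" for p
    unfolding r_def
    using accurate_selection_mean_ge [OF p A acc [OF cube_law_in_prob_algebra [OF p]] \<alpha>(1) bs(1,3)] .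
  ultimately have "\<exists>p. (\<forall>j<d. \<bar>p j\<bar> \<le> 1) \<and> 2 * (real k + 1) * \<alpha> * s
    \<le> (\<Sum>S\<in>?\<Omega>. sample_weight d p {1..n} S * (\<Sum>X\<in>?V. r S X * (\<Sum>i\<in>{1..n}. score X p (S i))))"
    using block_subset [OF _ bs(3)] block_nonempty [OF bs(1)] V(1) finite_transversals
    by (intro exists_mean_large_total_score [where B = "block b"]) auto
  then obtain p where p: "\<forall>j<d. \<bar>p j\<bar> \<le> 1" and T: "2 * (real k + 1) * \<alpha> * s
    \<le> (\<Sum>S\<in>?\<Omega>. sample_weight d p {1..n} S * (\<Sum>X\<in>?V. r S X * (\<Sum>i\<in>{1..n}. score X p (S i))))"
    by blast
  define N where "N = (\<Sum>S\<in>?\<Omega>. sample_weight d p {1..n} S *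
    (\<Sum>X\<in>?V. r S X * card {i \<in> {1..n}. l \<le> score X p (S i)}))"
  have ne: "?V \<noteq> {}"
    using block_argmax_in_transversals [OF bs(1)] by blast
  have "(\<Sum>S\<in>?\<Omega>. sample_weight d p {1..n} S * (\<Sum>X\<in>?V. r S X * (\<Sum>i\<in>{1..n}. score X p (S i))))
      \<le> card {1..n} * l + \<eta> * s / 2 * N + (ln (card ?V) + card {1..n}) / \<eta>"
    unfolding N_def
  proof (rule expected_total_score_le [OF p _ finite_transversals ne])
    fix S assume S: "S \<in> ?\<Omega>"
    show "0 \<le> r S X" "r S X \<le> 1" for X
      unfolding r_def by (rule statistic_law_bounds [OF A S])+
    show "(\<Sum>X\<in>?V. r S X) = 1"
      unfolding r_def by (rule sum_statistic_law [OF A S J finite_transversals])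
  qed (use V \<eta> \<xi> in \<open>auto simp: l_def\<close>)
  also have "\<dots> \<le> n * l + \<eta> * s / 2 * N + (s * ln b + n) / \<eta>"
  proof -
    have "card ?V > 0"
      using ne finite_transversals by (simp add: card_gt_0_iff)
    then have "ln (real (card ?V)) \<le> ln (real (b ^ s))"
      using card_transversals_le [of s b] bs by (subst ln_le_cancel_iff) (auto simp del: of_nat_power)
    also have "\<dots> = s * ln b"
      using bs by (simp add: ln_realpow)
    finally have "ln (real (card ?V)) \<le> s * ln b" .
    then show ?thesis
      using \<eta> by (intro add_mono divide_right_mono) auto
  qed
  finally have "2 * (real k + 1) * \<alpha> * s \<le> n * l + \<eta> * s / 2 * N + (s * ln b + n) / \<eta>"
    using T by linarith
  then have "(real k + 1) * \<alpha> * s \<le> \<eta> * s / 2 * N"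
    using noise union unfolding l_def by linarith
  then have "(2 * (real k + 1) * \<alpha>) * s \<le> (N * \<eta>) * s"
    by (simp add: mult_ac)
  then have "2 * (real k + 1) * \<alpha> \<le> N * \<eta>"
    using bs by simp
  then have "2 * (real k + 1) * \<alpha> / \<eta> \<le> N"
    using \<eta> by (simp add: pos_divide_le_eq)
  then show ?thesis
    using V by (intro traceable_by_score [OF p A J finite_transversals _ bs(2) \<xi>])
      (auto simp: N_def r_def l_def)
qed

section \<open>Choice of the parameters\<close>

text \<open>The value 40000 makes ln d / 2000 at least 20. The exponent 0.985 is 0.99 with a margin
  for a factor 2 and for rounding in the number of blocks, 0.4925 is half of it, and 0.002 = 0.01 -
  0.008 is the exponent for the expected number of large means in a block.\<close>

lemma eventually_dimension:
  "eventually (\<lambda>d::nat. 40000 \<le> ln (real d) \<and> d powr 0.985 \<le> d powr 0.99 / 2 - 1 \<and>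
      exp (- (d powr 0.002 / 4)) \<le> 1 / 30 \<and>
      2 * sqrt 2 * d powr 0.49 \<le> ln (real d) / 4000 * d powr 0.4925 \<and> 1 \<le> d powr 0.01) at_top"
  by (intro eventually_conj; real_asymp)

lemma one_minus_power_ge_exp:
  fixes x :: real
  assumes "0 \<le> x" "x \<le> 1 / 4"
  shows "exp (- (2 * x * k)) \<le> (1 - x) ^ k"
proof -
  have "x\<^sup>2 \<le> x * (1 / 4)"
    unfolding power2_eq_square using assms by (intro mult_left_mono) auto
  then have "- 2 * x \<le> - x - 2 * x\<^sup>2"
    using assms by simp
  also have "\<dots> \<le> ln (1 - x)"
    using assms by (intro ln_one_minus_pos_lower_bound) auto
  finally have "exp (- 2 * x) \<le> 1 - x"
    using assms by (simp add: ln_ge_iff)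
  then have "exp (- 2 * x) ^ k \<le> (1 - x) ^ k"
    by (intro power_mono) auto
  then show ?thesis
    by (simp add: exp_of_nat_mult [symmetric] mult_ac)
qed

lemma parameter_choice:
  fixes d n :: nat and \<xi> \<alpha> :: real
  assumes d: "40000 \<le> ln (real d)" "d powr 0.985 \<le> d powr 0.99 / 2 - 1"
      "exp (- (d powr 0.002 / 4)) \<le> 1 / 30"
      "2 * sqrt 2 * d powr 0.49 \<le> ln (real d) / 4000 * d powr 0.4925" "1 \<le> d powr 0.01"
    and n: "n \<ge> 1" and \<xi>: "0 < \<xi>" "\<xi> < 1 / exp 1" and \<alpha>: "\<alpha> > 0" "\<alpha> \<le> 1 / 8"
    and lo: "sqrt (ln (real d) / n) \<le> \<alpha>"
    and hi: "\<alpha> \<le> d powr 0.49 / (n * sqrt (ln (1 / \<xi>)))"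
  obtains b s k :: nat where "b > 0" "s > 0" "s * b \<le> d" "2 \<le> (2 * real k + 3) * \<alpha>\<^sup>2"
    "2 * \<alpha> \<le> 3 * \<alpha> * (1 - (1 - (1 - 16 * \<alpha>\<^sup>2) ^ k / 4) ^ b) - (\<alpha> + 1 / (\<alpha> * (2 * real k + 3))) / 2"
    "n * sqrt (2 * real s * ln (1 / \<xi>)) \<le> (real k + 1) * \<alpha> * s / 2"
    "(s * ln b + n) / (320 * \<alpha>) \<le> (real k + 1) * \<alpha> * s / 2"
    "ln (real d) / (4000 * \<alpha>\<^sup>2) \<le> real k + 1"
proof -
  define D where "D = ln (real d)"
  have D: "40000 \<le> D"
    using d by (simp add: D_def)
  have "d > 0"
    using d(1) by (cases "d = 0") auto
  then have dr: "real d > 0" "real d \<ge> 1"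
    by auto
  have "exp 1 * \<xi> < 1"
    using \<xi> by (simp add: field_simps)
  then have "exp 1 \<le> 1 / \<xi>"
    using \<xi> by (simp add: field_simps)
  then have L: "1 \<le> ln (1 / \<xi>)"
    using \<xi> by (subst ln_ge_iff) auto
  \<comment> \<open>The prior mass above 3 \<alpha> is at least exp (- 32 k \<alpha>^2) / 4. The
    constant 4000 makes 32 k \<alpha>^2 at most 0.008 ln d, below the 0.01 ln d available from the
    block size.\<close>
  define k where "k = nat \<lfloor>D / (4000 * \<alpha>\<^sup>2)\<rfloor>"
  have k_nonneg: "0 \<le> D / (4000 * \<alpha>\<^sup>2)"
    using D by (intro divide_nonneg_nonneg) auto
  then have k_le: "real k \<le> D / (4000 * \<alpha>\<^sup>2)" and k_ge: "D / (4000 * \<alpha>\<^sup>2) \<le> real k + 1"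
    unfolding k_def by linarith+
  have k_le': "k * \<alpha>\<^sup>2 \<le> D / 4000" and k_ge': "D / 4000 \<le> (real k + 1) * \<alpha>\<^sup>2"
    using k_le k_ge \<alpha> by (simp_all add: field_simps)
  have k_ge'': "D / (4000 * \<alpha>) \<le> (real k + 1) * \<alpha>"
    using k_ge' \<alpha> by (simp add: field_simps power2_eq_square)
  \<comment> \<open>Rounding up keeps every block large enough for its maximum; it at most doubles
    the block size and so at most about halves the number of blocks.\<close>
  define b where "b = nat \<lceil>d powr 0.01\<rceil>"
  have b_ge: "d powr 0.01 \<le> b" and "b \<le> d powr 0.01 + 1"
    using d(5) unfolding b_def by linarith+
  then have b_le: "b \<le> 2 * d powr 0.01" and b: "b > 0"
    using d(5) by linarith+
  define s where "s = d div b"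
  have sb: "s * b \<le> d"
    by (simp add: s_def)
  have s_ge: "d powr 0.985 \<le> s"
  proof -
    have "d powr 0.99 * d powr 0.01 = d"
      using dr by (simp add: powr_add [symmetric])
    then have "d powr 0.99 / 2 * b \<le> d"
      using b_le mult_left_mono [OF b_le, of "d powr 0.99 / 2"] by simp
    then have "d powr 0.99 / 2 \<le> real d / b"
      using b by (simp add: field_simps)
    also have "\<dots> \<le> s + 1"
    proof -
      have "d \<le> (s + 1) * b"
        using dividend_less_div_times [OF b, of d] by (simp add: s_def)
      then have "real d \<le> real ((s + 1) * b)"
        by (rule of_nat_mono)
      then show ?thesis
        using b by (simp add: pos_divide_le_eq algebra_simps)
    qed
    finally show ?thesis
      using d(2) by linarith
  qed
  have "1 \<le> d powr 0.985"
    using dr by (simp add: ge_one_powr_ge_zero)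
  with s_ge have s: "s > 0"
    by (cases "s = 0") auto
  have ln_b: "ln b \<le> D / 50"
  proof -
    have "ln b \<le> ln (2 * d powr 0.01)"
      using b b_le dr by (subst ln_le_cancel_iff) auto
    also have "\<dots> = ln 2 + 0.01 * D"
      using dr by (simp add: ln_mult ln_powr D_def)
    also have "\<dots> \<le> 1 + 0.01 * D"
      using ln_2_less_1 by simp
    finally show ?thesis
      using D by simp
  qed
  have n_sqrt: "n * sqrt (ln (1 / \<xi>)) \<le> d powr 0.49 / \<alpha>"
    using hi \<alpha> n L by (simp add: field_simps)
  \<comment> \<open>Both bounds on \<alpha> and ln (1/\<xi>) \<ge> 1 give sqrt (n D) \<le> n
    \<alpha> sqrt (ln (1/\<xi>)) \<le> d^0.49, hence n \<le> n D \<le> d^0.98.\<close>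
  have n_le: "n \<le> s"
  proof -
    have "n * sqrt (D / n) * 1 \<le> n * \<alpha> * sqrt (ln (1 / \<xi>))"
      using lo L \<alpha> D by (intro mult_mono mult_left_mono) (auto simp: D_def)
    also have "\<dots> \<le> d powr 0.49"
      using hi \<alpha> n L by (simp add: field_simps)
    finally have "(n * sqrt (D / n))\<^sup>2 \<le> (d powr 0.49)\<^sup>2"
      using D by (intro power_mono) auto
    moreover have "(n * sqrt (D / n))\<^sup>2 = n * D"
    proof -
      have "(sqrt (D / n))\<^sup>2 = D / n"
        using D by (intro real_sqrt_pow2) auto
      then have "(n * sqrt (D / n))\<^sup>2 = (real n)\<^sup>2 * (D / n)"
        by (simp only: power_mult_distrib)
      also have "\<dots> = n * D"
        using n by (simp add: power2_eq_square)
      finally show ?thesis .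
    qed
    moreover have "(d powr 0.49)\<^sup>2 = d powr 0.98"
      using dr by (simp add: power2_eq_square powr_add [symmetric])
    moreover have "real n * 1 \<le> n * D"
      using D by (intro mult_left_mono) auto
    moreover have "d powr 0.98 \<le> d powr 0.985"
      using dr by (intro powr_mono) auto
    ultimately have "real n \<le> real s"
      using s_ge by linarith
    then show ?thesis
      by simp
  qed
  show thesis
  proof
    show "b > 0" "s > 0" "s * b \<le> d"
      by fact+
    have "(2 * real k + 3) * \<alpha>\<^sup>2 = 2 * ((real k + 1) * \<alpha>\<^sup>2) + \<alpha>\<^sup>2"
      by (simp add: algebra_simps)
    then have k2: "D / 2000 \<le> (2 * real k + 3) * \<alpha>\<^sup>2"
      using k_ge' zero_le_power2 [of \<alpha>] by linarith
    with D show "2 \<le> (2 * real k + 3) * \<alpha>\<^sup>2"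
      by linarith
    show "ln (real d) / (4000 * \<alpha>\<^sup>2) \<le> real k + 1"
      using k_ge by (simp add: D_def)
    define q where "q = (1 - 16 * \<alpha>\<^sup>2) ^ k / 4"
    have "\<alpha>\<^sup>2 \<le> (1 / 8)\<^sup>2"
      using \<alpha> by (intro power_mono) auto
    then have \<alpha>2: "16 * \<alpha>\<^sup>2 \<le> 1 / 4" "0 \<le> 1 - 16 * \<alpha>\<^sup>2" "1 - 16 * \<alpha>\<^sup>2 \<le> 1"
      by (auto simp: power2_eq_square)
    have "d powr (- 0.008) = exp (- (0.008 * D))"
      using dr by (simp add: powr_def D_def)
    also have "\<dots> \<le> exp (- (2 * (16 * \<alpha>\<^sup>2) * k))"
      using k_le' by (simp add: mult_ac)
    also have "\<dots> \<le> (1 - 16 * \<alpha>\<^sup>2) ^ k"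
      using \<alpha>2 by (intro one_minus_power_ge_exp) auto
    finally have q_ge: "d powr (- 0.008) / 4 \<le> q"
      by (simp add: q_def)
    have q1: "q \<le> 1"
      using \<alpha>2 power_le_one [of "1 - 16 * \<alpha>\<^sup>2" k] by (simp add: q_def)
    have "d powr (- 0.008) * d powr 0.01 = d powr 0.002"
      using dr by (simp add: powr_add [symmetric])
    moreover have "d powr (- 0.008) / 4 * d powr 0.01 \<le> q * b"
      using q_ge b_ge by (intro mult_mono order_trans [OF _ q_ge]) auto
    ultimately have qb: "d powr 0.002 / 4 \<le> q * b"
      by simp
    have "(1 - q) ^ b \<le> exp (- q) ^ b"
      using q1 exp_ge_add_one_self [of "- q"] by (intro power_mono) auto
    also have "\<dots> = exp (- (q * b))"
      by (simp add: exp_of_nat_mult [symmetric] mult_ac)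
    also have "\<dots> \<le> exp (- (d powr 0.002 / 4))"
      using qb by simp
    finally have "(1 - q) ^ b \<le> 1 / 30"
      using d(3) by linarith
    then have "3 * \<alpha> * (1 - 1 / 30) \<le> 3 * \<alpha> * (1 - (1 - q) ^ b)"
      using \<alpha> by (intro mult_left_mono) auto
    moreover have "3 * \<alpha> * (1 - 1 / 30) = 29 / 10 * \<alpha>"
      by simp
    ultimately have 1: "29 / 10 * \<alpha> \<le> 3 * \<alpha> * (1 - (1 - q) ^ b)"
      by (simp only:)
    define y where "y = \<alpha> * (2 * real k + 3)"
    have "y > 0"
      using \<alpha> by (simp add: y_def)
    have "20 \<le> (2 * real k + 3) * \<alpha>\<^sup>2"
      using k2 D by linarith
    also have "\<dots> = \<alpha> * y"
      by (simp add: y_def power2_eq_square)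
    finally have "1 / y \<le> \<alpha> / 20"
      using \<open>y > 0\<close> by (simp add: field_simps)
    then have 2: "1 / (\<alpha> * (2 * real k + 3)) \<le> \<alpha> / 20"
      by (simp only: y_def)
    \<comment> \<open>Here 2.9 - 1.05 / 2 = 2.375 leaves room above 2.\<close>
    have "2 * \<alpha> \<le> X - (\<alpha> + Y) / 2" if "29 / 10 * \<alpha> \<le> X" "Y \<le> \<alpha> / 20" for X Y
      using that \<alpha>(1) by (simp add: field_simps)
    from this [OF 1 2] show "2 * \<alpha> \<le> 3 * \<alpha> * (1 - (1 - (1 - 16 * \<alpha>\<^sup>2) ^ k / 4) ^ b)
        - (\<alpha> + 1 / (\<alpha> * (2 * real k + 3))) / 2"
      unfolding q_def .
    have sqrt_s: "d powr 0.4925 \<le> sqrt s"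
    proof (rule real_le_rsqrt)
      have "(d powr 0.4925)\<^sup>2 = d powr 0.985"
        using dr by (simp add: power2_eq_square powr_add [symmetric])
      with s_ge show "(d powr 0.4925)\<^sup>2 \<le> s"
        by simp
    qed
    have "2 * sqrt 2 * d powr 0.49 \<le> D / 4000 * d powr 0.4925"
      using d(4) by (simp only: D_def)
    also have "\<dots> \<le> D / 4000 * sqrt s"
      using D by (intro mult_left_mono sqrt_s) auto
    finally have "2 * sqrt 2 * d powr 0.49 \<le> D / 4000 * sqrt s" .
    then have "2 * sqrt 2 * d powr 0.49 * sqrt s \<le> D / 4000 * sqrt s * sqrt s"
      by (intro mult_right_mono) auto
    then have *: "sqrt 2 * sqrt s * d powr 0.49 \<le> D / 4000 * s / 2"
      by (simp add: mult_ac)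
    have "n * sqrt (2 * real s * ln (1 / \<xi>)) = sqrt 2 * sqrt s * (n * sqrt (ln (1 / \<xi>)))"
      by (simp only: real_sqrt_mult mult_ac)
    also have "\<dots> \<le> sqrt 2 * sqrt s * (d powr 0.49 / \<alpha>)"
      using n_sqrt by (intro mult_left_mono) auto
    also have "\<dots> \<le> D / 4000 * s / 2 / \<alpha>"
      using divide_right_mono [OF *, of \<alpha>] \<alpha> by simp
    also have "\<dots> = D / (4000 * \<alpha>) * (s / 2)"
      by simp
    also have "\<dots> \<le> (real k + 1) * \<alpha> * (s / 2)"
      using k_ge'' by (intro mult_right_mono) auto
    finally show "n * sqrt (2 * real s * ln (1 / \<xi>)) \<le> (real k + 1) * \<alpha> * s / 2"
      by simp
    \<comment> \<open>Origin of 320: the exponent cost is at most s D / 25, and 25 * 320 = 8000 = 2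
      * 4000 matches exactly the half of (k + 1) \<alpha> s that may be spent.\<close>
    have "s * ln b \<le> s * (D / 50)"
      using ln_b by (intro mult_left_mono) auto
    moreover have "real s * 1 \<le> s * (D / 50)"
      using D by (intro mult_left_mono) auto
    ultimately have "s * ln b + n \<le> s * (D / 25)"
      using n_le by (simp add: field_simps)
    then have "(s * ln b + n) / (320 * \<alpha>) \<le> s * (D / 25) / (320 * \<alpha>)"
      using \<alpha> by (intro divide_right_mono) auto
    also have "\<dots> = D / (4000 * \<alpha>) * (s / 2)"
      by simp
    also have "\<dots> \<le> (real k + 1) * \<alpha> * (s / 2)"
      using k_ge'' by (intro mult_right_mono) auto
    finally show "(s * ln b + n) / (320 * \<alpha>) \<le> (real k + 1) * \<alpha> * s / 2"
      by simp
  qed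
qed

theorem corollary2p9:
  "\<exists>(c::real) > 0. \<exists>(c'::real) > 0. \<exists>d\<^sub>0::nat.
     \<forall>(d::nat) (n::nat) (\<xi>::real) (\<alpha>::real) (A :: (nat \<Rightarrow> nat \<Rightarrow> real) \<Rightarrow> (nat \<Rightarrow> real) measure).
       d \<ge> d\<^sub>0 \<longrightarrow> n \<ge> 1 \<longrightarrow> 0 < \<xi> \<longrightarrow> \<xi> < 1 / exp 1 \<longrightarrow> \<alpha> > 0 \<longrightarrow>
       c * sqrt (ln (real d) / real n) \<le> \<alpha> \<longrightarrow>
       \<alpha> \<le> min (c * (real d powr 0.49 / (real n * sqrt (ln (1 / \<xi>))))) (1 / 8) \<longrightarrow>
       estimator (sign_cube d) d n A \<longrightarrow>
       (\<forall>D \<in> space (prob_algebra (sign_cube d)).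
          (\<integral>\<^sup>+\<mu>. ennreal (linf_norm d (\<lambda>j. \<mu> j - (\<integral>z. z j \<partial>D))) \<partial>estimate_law n A D)
            \<le> ennreal (\<alpha> / 2)) \<longrightarrow>
       (\<exists>m::real. m \<ge> c' * ln (real d) / \<alpha>\<^sup>2 \<and> traceable (sign_cube d) d n A \<xi> m)"
proof -
  obtain d\<^sub>0 :: nat where d0: "\<And>d. d \<ge> d\<^sub>0 \<Longrightarrow> 40000 \<le> ln (real d) \<and> d powr 0.985 \<le> d powr 0.99 / 2 - 1 \<and>
      exp (- (d powr 0.002 / 4)) \<le> 1 / 30 \<and>
      2 * sqrt 2 * d powr 0.49 \<le> ln (real d) / 4000 * d powr 0.4925 \<and> 1 \<le> d powr 0.01"
    using eventually_dimension unfolding eventually_at_top_linorder by blast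
  show ?thesis
  \<comment> \<open>With \<eta> = 320 \<alpha> the number of traced points is at least (k + 1) /
    160, and 640000 = 160 * 4000.\<close>
  proof (rule exI [of _ 1], intro conjI, simp, rule exI [of _ "1 / 640000"], intro conjI, simp,
      rule exI [of _ d\<^sub>0], intro allI impI)
    fix d n :: nat and \<xi> \<alpha> :: real and A :: "(nat \<Rightarrow> nat \<Rightarrow> real) \<Rightarrow> (nat \<Rightarrow> real) measure"
    assume d: "d\<^sub>0 \<le> d" and n: "1 \<le> n" and \<xi>: "0 < \<xi>" "\<xi> < 1 / exp 1" and \<alpha>: "0 < \<alpha>"
      and lo: "1 * sqrt (ln (real d) / real n) \<le> \<alpha>"
      and hi: "\<alpha> \<le> min (1 * (real d powr 0.49 / (real n * sqrt (ln (1 / \<xi>))))) (1 / 8)"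
      and A: "estimator (sign_cube d) d n A"
      and acc: "\<forall>D \<in> space (prob_algebra (sign_cube d)).
          (\<integral>\<^sup>+\<mu>. ennreal (linf_norm d (\<lambda>j. \<mu> j - (\<integral>z. z j \<partial>D))) \<partial>estimate_law n A D)
            \<le> ennreal (\<alpha> / 2)"
    have "1 / exp 1 < (1 :: real)"
      by simp
    then have \<xi>1: "\<xi> < 1"
      using \<xi> by linarith
    have \<alpha>8: "\<alpha> \<le> 1 / 8" and lo': "sqrt (ln (real d) / n) \<le> \<alpha>"
      and hi': "\<alpha> \<le> d powr 0.49 / (n * sqrt (ln (1 / \<xi>)))"
      using lo hi by simp_all
    obtain b s k :: nat where bs: "b > 0" "s > 0" "s * b \<le> d" and k: "2 \<le> (2 * real k + 3) * \<alpha>\<^sup>2"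
      "2 * \<alpha> \<le> 3 * \<alpha> * (1 - (1 - (1 - 16 * \<alpha>\<^sup>2) ^ k / 4) ^ b) - (\<alpha> + 1 / (\<alpha> * (2 * real k + 3))) / 2"
      "n * sqrt (2 * real s * ln (1 / \<xi>)) \<le> (real k + 1) * \<alpha> * s / 2"
      "(s * ln b + n) / (320 * \<alpha>) \<le> (real k + 1) * \<alpha> * s / 2"
      and k_ge: "ln (real d) / (4000 * \<alpha>\<^sup>2) \<le> real k + 1"
      using d0 [OF d] by (rule_tac parameter_choice [OF _ _ _ _ _ n \<xi> \<alpha> \<alpha>8 lo' hi']) auto
    have "0 < 320 * \<alpha>"
      using \<alpha> by simp
    then have "traceable (sign_cube d) d n A \<xi> (2 * (real k + 1) * \<alpha> / (320 * \<alpha>))"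
      using acc by (intro traceable_of_accurate [OF A _ \<alpha> \<alpha>8 \<xi>(1) \<xi>1 _ bs k]) auto
    moreover have "1 / 640000 * ln (real d) / \<alpha>\<^sup>2 \<le> 2 * (real k + 1) * \<alpha> / (320 * \<alpha>)"
    proof -
      have "1 / 640000 * ln (real d) / \<alpha>\<^sup>2 = ln (real d) / (4000 * \<alpha>\<^sup>2) / 160"
        by simp
      also have "\<dots> \<le> (real k + 1) / 160"
        using k_ge by (rule divide_right_mono) simp
      also have "\<dots> = 2 * (real k + 1) * \<alpha> / (320 * \<alpha>)"
        using \<alpha> by simp
      finally show ?thesis .
    qed
    ultimately show "\<exists>m::real. m \<ge> 1 / 640000 * ln (real d) / \<alpha>\<^sup>2 \<and> traceable (sign_cube d) d n A \<xi> m"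
      by blast
  qed
qed

end
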